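(* Let $\{\varphi_r\}_{0<r<1}\subset L^\infty(\mathbb T)$ be a family of kernels satisfying conditions $\Phi1$, $\Phi4$, $\Phi5$, and let $\lambda\in C[0,1]$ satisfy $\lambda(1)=0$ and $$\Pi^*(\lambda,\varphi)=\limsup_{\delta\to0}\liminf_{r\to1}\int_{-\delta\lambda(r)}^{\delta\lambda(r)}\varphi_r(t)\,dt=1 .$$ Then there exists a function $B\in L^\infty(\mathbb T)$, which is the boundary function of a Blaschke product, such that the limit $$\lim_{r\to1}\Phi_r\left(x+\lambda(r),B\right)$$ does not exist for any $x\in\mathbb T$.
   Context: $\mathbb T=\mathbb R/2\pi\mathbb Z$. The conditions on the kernels are: ($\Phi1$) $\int_{\mathbb T}\varphi_r(t)\,dt\to1$ as $r\to1$; ($\Phi4$) $\varphi_r(x)\ge0$ for $x\in\mathbb T$, $0<r<1$; ($\Phi5$) for any numbers $\gamma>0$ and $0<\tau<1$ there exists $\delta>0$ such that $\int_e\varphi_r(t)\,dt<\gamma$ for all $0<r<\tau$ and every measurable $e\subset\mathbb T$ with $|e|<\delta$. $\Phi_r(x,f):=\int_{\mathbb T}\varphi_r(x-t)f(t)\,dt$ (here $f=B$ is complex-valued). In $\Pi^*$, $\delta\to0$ through positive values. $C[0,1]$ consists of real-valued continuous functions. The boundary function of a Blaschke product $b(z)$ on the unit disc is $x\mapsto\lim_{\rho\to1}b(\rho e^{ix})$, defined for a.e. $x\in\mathbb T$. *)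

theory Defs
  imports "HOL-Analysis.Analysis"
begin

text \<open>
  Functions on the circle \<open>\<real>/2\<pi>\<int>\<close> are represented by \<open>2\<pi>\<close>-periodic functions on \<open>\<real>\<close>, and subsets of
  the circle by subsets of the fundamental domain \<open>[-\<pi>, \<pi>)\<close>.
\<close>

abbreviation circle_dom :: "real set" where
  "circle_dom \<equiv> {-pi..<pi}"

definition Linf_circle :: "(real \<Rightarrow> 'a::{real_normed_vector, second_countable_topology}) \<Rightarrow> bool" where
  "Linf_circle f \<longleftrightarrow>
     (\<forall>x. f (x + 2 * pi) = f x) \<and>
     f \<in> borel_measurable lebesgue \<and>
     (\<exists>C. AE x in lebesgue. norm (f x) \<le> C)"

text \<open>
  A family of kernels \<open>\<phi> r\<close> is indexed by \<open>0 < r < 1\<close>; values at other \<open>r\<close> are never used.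
\<close>

definition Phi1 :: "(real \<Rightarrow> real \<Rightarrow> real) \<Rightarrow> bool" where
  "Phi1 \<phi> \<longleftrightarrow> ((\<lambda>r. LINT t:circle_dom|lebesgue. \<phi> r t) \<longlongrightarrow> 1) (at_left 1)"

definition Phi4 :: "(real \<Rightarrow> real \<Rightarrow> real) \<Rightarrow> bool" where
  "Phi4 \<phi> \<longleftrightarrow> (\<forall>r x. 0 < r \<and> r < 1 \<longrightarrow> \<phi> r x \<ge> 0)"

definition Phi5 :: "(real \<Rightarrow> real \<Rightarrow> real) \<Rightarrow> bool" where
  "Phi5 \<phi> \<longleftrightarrow>
     (\<forall>\<gamma> \<tau>. 0 < \<gamma> \<and> 0 < \<tau> \<and> \<tau> < 1 \<longrightarrow>
        (\<exists>\<delta>>0. \<forall>r e. 0 < r \<and> r < \<tau> \<and> e \<in> sets lebesgue \<and> e \<subseteq> circle_dom \<and> measure lebesgue e < \<delta>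
                  \<longrightarrow> (LINT t:e|lebesgue. \<phi> r t) < \<gamma>))"

definition kernel_integral ::
    "(real \<Rightarrow> real \<Rightarrow> real) \<Rightarrow> real \<Rightarrow> real \<Rightarrow> (real \<Rightarrow> complex) \<Rightarrow> complex" where
  "kernel_integral \<phi> r x f = (LINT t:circle_dom|lebesgue. complex_of_real (\<phi> r (x - t)) * f t)"

text \<open>
  The inner integral is oriented: it changes sign when \<open>l r < 0\<close>.
\<close>

definition Pi_star :: "(real \<Rightarrow> real) \<Rightarrow> (real \<Rightarrow> real \<Rightarrow> real) \<Rightarrow> ereal" where
  "Pi_star l \<phi> =
     Limsup (at_right 0) (\<lambda>\<delta>::real.
       Liminf (at_left 1) (\<lambda>r::real.
         ereal (LINT t=ereal (- \<delta> * l r)..ereal (\<delta> * l r)|lebesgue. \<phi> r t)))"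

text \<open>
  The zeros, repeated according to multiplicity, are \<open>a n\<close> for \<open>n \<in> I\<close>, so that both finite and infinite
  products are covered; a zero at the origin contributes the factor \<open>z\<close>.  No unimodular constant is
  included.
\<close>

definition blaschke_factor :: "complex \<Rightarrow> complex \<Rightarrow> complex" where
  "blaschke_factor a z =
     (if a = 0 then z else complex_of_real (norm a) / a * ((a - z) / (1 - cnj a * z)))"

definition is_blaschke_product :: "(complex \<Rightarrow> complex) \<Rightarrow> bool" where
  "is_blaschke_product b \<longleftrightarrow>
     (\<exists>(I :: nat set) a.
        (\<forall>n\<in>I. norm (a n) < 1) \<and>
        (\<lambda>n. 1 - norm (a n)) summable_on I \<and>
        (\<forall>z\<in>ball 0 1. (\<lambda>n. if n \<in> I then blaschke_factor (a n) z else 1) has_prod b z))"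

definition is_boundary_function :: "(real \<Rightarrow> complex) \<Rightarrow> (complex \<Rightarrow> complex) \<Rightarrow> bool" where
  "is_boundary_function B b \<longleftrightarrow>
     (AE x in lebesgue. ((\<lambda>\<rho>::real. b (complex_of_real \<rho> * cis x)) \<longlongrightarrow> B x) (at_left 1))"

end

theory Submission
  imports Defs
begin

text \<open>
  The hypothesis on \<open>\<Pi>\<^sup>*\<close> says that the kernels concentrate at a scale much smaller than \<open>\<lambda>(r)\<close>: the inner
  integral increases with \<open>\<delta>\<close>, so for \<^emph>\<open>every\<close> \<open>\<delta> > 0\<close> almost all of the mass of \<open>\<phi>\<^sub>r\<close> lies in
  \<open>|t| < \<delta> \<lambda>(r)\<close> once \<open>r\<close> is close to 1 (\<open>Pi_star_concentration\<close>).  Hence \<open>\<Phi>\<^sub>r(x + \<lambda>(r), B)\<close> is nearly an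
  average of \<open>B\<close> over a window around \<open>x + \<lambda>(r)\<close> that is tiny compared with \<open>\<lambda>(r)\<close>.  As \<open>\<lambda>\<close> is continuous,
  positive near 1, and tends to 0, the centres \<open>x + \<lambda>(r)\<close> sweep through all points slightly to the right
  of \<open>x\<close>.  It therefore suffices to build a function that takes two well separated values on such windows
  to the right of every \<open>x\<close>, at arbitrarily small scales.

  The building block is the finite Blaschke product
  \<open>b(z) = (a - z\<^sup>N) / (1 - a z\<^sup>N)\<close> with \<open>a = exp (-\<eta>)\<close>, whose zeros are the \<open>N\<close>-th roots of \<open>a\<close>.  At \<open>z = cis t\<close> it
  equals -1 where \<open>N t \<in> 2\<pi>\<int>\<close> and 1 half way between these grid points; and when \<open>\<eta>\<close> is small, it is close
  to 1 except near the grid, in an exceptional set whose measure is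
  bounded independently of \<open>N\<close>.  The product is
  \<open>B = b\<^sub>0 b\<^sub>1 b\<^sub>2 \<dots>\<close>, and the parameters are fixed stage by stage in the following order.

  \<^item> \<open>\<eta>\<close> so small that the new factor is harmless for all the earlier stages;
  \<^item> \<open>\<delta>\<close> so small, compared with \<open>1 - a\<close>, that \<open>b\<close> is nearly constant on a window of radius \<open>\<delta> s\<close> when
    \<open>s \<le> 4\<pi>/N\<close>; this does not involve \<open>N\<close>, since \<open>b\<close> depends on \<open>N t\<close> alone;
  \<^item> \<open>r\<^sub>1\<close> so close to 1 that \<open>\<phi>\<^sub>r\<close> lives on the window \<open>\<delta> \<lambda>(r)\<close> for \<open>r \<ge> r\<^sub>1\<close>;
  \<^item> \<open>N\<close> so large that all distances up to \<open>4\<pi>/N\<close> are values \<open>\<lambda>(r)\<close> with \<open>r \<ge> r\<^sub>1\<close>, and that the product of the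
    earlier factors is nearly constant at that scale;
  \<^item> \<open>\<tau> < 1\<close> with \<open>\<lambda>(r) < 2\<pi>/N\<close> for \<open>r \<ge> \<tau>\<close>, so that only the \<open>r < \<tau>\<close> matter for this stage, and then, by
    condition \<open>\<Phi>5\<close>, a bound on the total measure of all later exceptional sets.

  Each \<open>x\<close> has, at distances between \<open>2\<pi>/N\<close> and \<open>4\<pi>/N\<close> to its right, both a grid point and a midpoint.  So
  \<open>\<Phi>\<^sub>r(x + \<lambda>(r), B)\<close> comes near both \<open>-p\<close> and \<open>p\<close>, where \<open>|p| = 1\<close> is the value of the earlier product at \<open>x\<close>, for
  suitable \<open>r\<close> in \<open>[r\<^sub>1, \<tau>)\<close> (\<open>oscillation_stage\<close>).  This happens at every stage, so the limit does not exist.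

  The radial limits come from the same estimates.  The bound on \<open>b - 1\<close> off the exceptional set holds along
  the whole radius, and by Borel--Cantelli almost every \<open>x\<close> belongs to finitely many exceptional sets.  So
  along almost every closed radius the infinite product converges uniformly, and its radial limit is
  the product of the boundary values.
\<close>

section \<open>Disc automorphisms and products over roots of unity\<close>

text \<open>
  The involution of the unit disc that exchanges 0 and \<open>a\<close>.
\<close>

definition disc_map :: "real \<Rightarrow> complex \<Rightarrow> complex" where
  "disc_map a w = (of_real a - w) / (1 - of_real a * w)"

lemma disc_map_denominator_nonzero:
  assumes "0 \<le> a" "a < 1" "norm w \<le> 1"
  shows "1 - of_real a * w \<noteq> (0::complex)"
proof
  assume "1 - of_real a * w = 0"
  then have "norm (of_real a * w) = 1" by (metis eq_iff_diff_eq_0 norm_one)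
  moreover have "norm (of_real a * w) \<le> a * 1"
    unfolding norm_mult using assms by (intro mult_mono) auto
  ultimately show False using assms by simp
qed

lemma disc_map_modulus_identity:
  "(norm (1 - of_real a * w))\<^sup>2 - (norm (of_real a - w :: complex))\<^sup>2 = (1 - a\<^sup>2) * (1 - (norm w)\<^sup>2)"
  unfolding cmod_power2 by (simp add: power2_eq_square algebra_simps)

lemma norm_disc_map_le_1:
  assumes "0 \<le> a" "a < 1" "norm w \<le> 1"
  shows "norm (disc_map a w) \<le> 1"
proof -
  have "0 \<le> (1 - a\<^sup>2) * (1 - (norm w)\<^sup>2)"
    using assms by (intro mult_nonneg_nonneg) (auto simp: abs_square_le_1)
  then have "norm (of_real a - w) \<le> norm (1 - of_real a * w)"
    unfolding disc_map_modulus_identity[symmetric] by (simp add: abs_le_square_iff[symmetric])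
  then show ?thesis
    using disc_map_denominator_nonzero[OF assms] by (simp add: disc_map_def norm_divide)
qed

lemma norm_disc_map_eq_1:
  assumes "0 \<le> a" "a < 1" "norm w = 1"
  shows "norm (disc_map a w) = 1"
proof -
  have "(norm (of_real a - w))\<^sup>2 = (norm (1 - of_real a * w))\<^sup>2"
    using disc_map_modulus_identity[of a w] assms by simp
  then have "norm (of_real a - w) = norm (1 - of_real a * w)"
    by (simp add: power2_eq_iff_nonneg)
  then show ?thesis
    using disc_map_denominator_nonzero[of a w] assms by (simp add: disc_map_def norm_divide)
qed

text \<open>
  The numerator of the difference is \<open>-(1 - a) (1 + w)\<close>, hence small for \<open>a\<close> near 1 unless the denominator
  is small too, that is, unless \<open>w\<close> is near 1.
\<close>

lemma norm_disc_map_minus_1: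
  assumes "0 \<le> a" "a < 1" "norm w \<le> 1"
  shows "norm (disc_map a w - 1) \<le> 2 * (1 - a) / norm (1 - of_real a * w)"
proof -
  have "disc_map a w - 1 = - (of_real (1 - a) * (1 + w)) / (1 - of_real a * w)"
    using disc_map_denominator_nonzero[OF assms] by (simp add: disc_map_def field_simps)
  then have "norm (disc_map a w - 1) = (1 - a) * norm (1 + w) / norm (1 - of_real a * w)"
    using assms by (simp add: norm_divide norm_mult del: of_real_diff)
  moreover have "norm (1 + w) \<le> 2"
    using norm_triangle_ineq[of 1 w] assms by simp
  ultimately show ?thesis
    using assms mult_left_mono[of "norm (1 + w)" 2 "1 - a"]
    by (auto intro!: divide_right_mono simp: mult.commute)
qed

text \<open>
  The constant controls the size of the windows on which a factor is nearly constant.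
\<close>

lemma disc_map_lipschitz:
  assumes a: "0 \<le> a" "a < 1" and u: "norm u \<le> 1" and v: "norm v \<le> 1"
  shows "norm (disc_map a u - disc_map a v) \<le> 2 / (1 - a) * norm (u - v)"
proof -
  have den: "1 - a \<le> norm (1 - of_real a * w)" if "norm w \<le> 1" for w :: complex
  proof -
    have "norm (of_real a * w) \<le> a * 1"
      unfolding norm_mult using a that by (intro mult_mono) auto
    then show ?thesis using norm_triangle_ineq2[of 1 "of_real a * w"] by simp
  qed
  have "disc_map a u - disc_map a v
      = of_real (1 - a\<^sup>2) * (v - u) / ((1 - of_real a * u) * (1 - of_real a * v))"
    using disc_map_denominator_nonzero[OF a u] disc_map_denominator_nonzero[OF a v]
    by (simp add: disc_map_def field_simps power2_eq_square)
  then have "norm (disc_map a u - disc_map a v)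
      = (1 - a\<^sup>2) * norm (u - v) / (norm (1 - of_real a * u) * norm (1 - of_real a * v))"
    using a by (simp add: norm_divide norm_mult norm_minus_commute abs_square_le_1 del: of_real_diff)
  also have "\<dots> \<le> (1 - a\<^sup>2) * norm (u - v) / ((1 - a) * (1 - a))"
    using a den[OF u] den[OF v]
    by (intro divide_left_mono mult_mono mult_nonneg_nonneg mult_pos_pos)
       (auto simp: abs_square_le_1)
  also have "\<dots> = (1 + a) / (1 - a) * norm (u - v)"
  proof -
    have "1 - a\<^sup>2 = (1 + a) * (1 - a)" by (simp add: power2_eq_square algebra_simps)
    then show ?thesis using a by simp
  qed
  also have "\<dots> \<le> 2 / (1 - a) * norm (u - v)"
    using a by (intro mult_right_mono divide_right_mono) auto
  finally show ?thesis .
qed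

lemma continuous_on_disc_map:
  assumes "0 \<le> a" "a < 1" "continuous_on S f" "\<And>s. s \<in> S \<Longrightarrow> norm (f s) \<le> 1"
  shows "continuous_on S (\<lambda>s. disc_map a (f s))"
  unfolding disc_map_def using assms disc_map_denominator_nonzero by (intro continuous_intros) auto

lemma blaschke_factor_eq_disc_map:
  assumes "0 < a"
  shows "blaschke_factor (of_real a * cis \<theta>) z = disc_map a (cis (- \<theta>) * z)"
proof -
  have "cis \<theta> * cis (-\<theta>) = 1" by (simp add: cis_mult)
  then have "of_real a * cis \<theta> - z = cis \<theta> * (of_real a - cis (-\<theta>) * z)"
    by (simp add: algebra_simps flip: mult.assoc)
  then show ?thesis
    using assms by (simp add: blaschke_factor_def disc_map_def norm_mult cis_cnj mult.assoc)
qed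

lemma prod_lessThan_add:
  "(\<Prod>i<m + n. f i) = (\<Prod>i<m. f i) * (\<Prod>j<n. f (m + j))" for f :: "nat \<Rightarrow> 'a :: comm_monoid_mult"
  by (induction n) (simp_all add: mult_ac)

text \<open>
  The roots of unity of order \<open>2 ^ Suc k\<close> come in pairs \<open>v\<close>, \<open>-v\<close>, and the factors of such a pair multiply to the
  same expression in \<open>a\<^sup>2\<close> and \<open>v\<^sup>2\<close>.  This halving is the reason for using powers of two as degrees.
\<close>

lemma prod_disc_map_roots_of_unity:
  assumes "0 \<le> a" "a < 1" "norm z \<le> 1"
  shows "(\<Prod>j<2^k. disc_map a (cis (- (2 * pi * real j / 2^k)) * z)) = disc_map (a^2^k) (z^2^k)"
  using assms
proof (induction k arbitrary: a z)
  case 0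
  then show ?case by simp
next
  case (Suc k)
  define w where "w j = cis (- (2 * pi * real j / 2^Suc k)) * z" for j
  have opp: "w (2^k + j) = - w j" for j
  proof -
    have "cis (- (2 * pi * real (2^k + j) / 2^Suc k)) = cis (- pi) * cis (- (2 * pi * real j / 2^Suc k))"
      unfolding cis_mult by (intro arg_cong[where f = cis]) (simp add: field_simps)
    then show ?thesis by (simp add: w_def flip: cis_inverse)
  qed
  have sq: "(w j)\<^sup>2 = cis (- (2 * pi * real j / 2^k)) * z\<^sup>2" for j
  proof -
    have "(cis (- (2 * pi * real j / 2^Suc k)))\<^sup>2 = cis (- (2 * pi * real j / 2^k))"
      unfolding Complex.DeMoivre by (rule arg_cong[where f = cis]) simp
    then show ?thesis by (simp add: w_def power_mult_distrib)
  qed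
  have nw: "norm (w j) \<le> 1" for j using Suc.prems by (simp add: w_def norm_mult)
  have pair: "disc_map a v * disc_map a (- v) = disc_map (a\<^sup>2) (v\<^sup>2)" for v
  proof -
    have "(of_real a - v) * (of_real a - - v) = of_real (a\<^sup>2) - v\<^sup>2"
      "(1 - of_real a * v) * (1 - of_real a * - v) = 1 - of_real (a\<^sup>2) * v\<^sup>2"
      by (simp_all add: power2_eq_square algebra_simps)
    then show ?thesis unfolding disc_map_def times_divide_times_eq by (rule arg_cong2)
  qed
  have "(\<Prod>j<2^Suc k. disc_map a (w j)) = (\<Prod>j<2^k. disc_map a (w j)) * (\<Prod>j<2^k. disc_map a (w (2^k + j)))"
    using prod_lessThan_add[of "\<lambda>j. disc_map a (w j)" "2^k" "2^k"] by (simp add: mult_2)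
  also have "\<dots> = (\<Prod>j<2^k. disc_map (a\<^sup>2) (cis (- (2 * pi * real j / 2^k)) * z\<^sup>2))"
    unfolding prod.distrib[symmetric] opp pair sq ..
  also have "\<dots> = disc_map ((a\<^sup>2)^2^k) ((z\<^sup>2)^2^k)"
    using Suc.prems by (intro Suc.IH) (auto simp: abs_square_less_1 norm_power power_le_one)
  finally show ?case by (simp add: w_def power_mult[symmetric])
qed

section \<open>Blaschke factors close to one off a periodic grid\<close>

lemma norm_cis_diff_le: "norm (cis x - cis y) \<le> \<bar>x - y\<bar>"
proof -
  have "cis x - cis y = cis y * (cis (x - y) - 1)"
    by (simp add: algebra_simps cis_mult)
  then have "norm (cis x - cis y) = norm (cis (x - y) - 1)" by (simp add: norm_mult)
  also have "\<dots> = norm (exp (\<i> * of_real (x - y)) - 1)" by (simp add: cis_conv_exp)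
  also have "\<dots> \<le> \<bar>x - y\<bar>"
    unfolding dist_exp_i_1 using abs_sin_x_le_abs_x[of "(x - y) / 2"] by simp
  finally show ?thesis .
qed

lemma norm_one_minus_cis_ge:
  assumes "0 \<le> h" "h \<le> pi" and far: "\<And>j::int. h \<le> \<bar>y - 2 * pi * of_int j\<bar>"
  shows "sqrt (2 - 2 * cos h) \<le> norm (1 - cis y)"
proof -
  define j where "j = round (y / (2 * pi))"
  define y' where "y' = y - 2 * pi * of_int j"
  have "\<bar>of_int j - y / (2 * pi)\<bar> \<le> 1 / 2"
    unfolding j_def by (rule of_int_round_abs_le)
  then have "\<bar>y'\<bar> \<le> pi"
    unfolding y'_def by (simp add: abs_le_iff field_simps)
  then have "cos \<bar>y'\<bar> \<le> cos h"
    using assms far[of j] by (intro cos_monotone_0_pi_le) (auto simp: y'_def)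
  moreover have "cos \<bar>y'\<bar> = cos y"
    by (simp add: y'_def cos_diff)
  moreover have "(norm (1 - cis y))\<^sup>2 = 2 - 2 * cos y"
    using sin_cos_squared_add[of y] unfolding cmod_power2
    by (simp add: power2_eq_square algebra_simps)
  ultimately have "2 - 2 * cos h \<le> (norm (1 - cis y))\<^sup>2" by simp
  then show ?thesis
    by (simp add: real_le_lsqrt)
qed

text \<open>
  Moving from \<open>t u\<close> to \<open>u\<close> along the radius costs \<open>1 - t\<close>, which is itself at most the distance from \<open>t u\<close>
  to 1.  Through this bound estimates on the circle become uniform along the radius.
\<close>

lemma norm_one_minus_ray_ge:
  assumes "norm u = 1" "0 \<le> t" "t \<le> 1"
  shows "norm (1 - u) / 2 \<le> norm (1 - of_real t * u :: complex)"
proof -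
  have "norm (of_real (1 - t) * u) \<le> norm (1 - of_real t * u)"
    using assms norm_triangle_ineq2[of 1 "of_real t * u"] by (simp add: norm_mult del: of_real_diff)
  moreover have "norm (1 - u) \<le> norm (1 - of_real t * u) + norm (of_real (1 - t) * u)"
    using norm_triangle_ineq4[of "1 - of_real t * u" "of_real (1 - t) * u"]
    by (simp add: algebra_simps)
  ultimately show ?thesis by simp
qed

text \<open>
  The finite Blaschke product of degree \<open>2\<^sup>k\<close>.  The parameter \<open>exp (-\<eta>)\<close> makes its zeros have modulus
  \<open>exp (-\<eta> / 2\<^sup>k)\<close>, so that their distances to the circle add up to at most \<open>\<eta>\<close>.
\<close>

definition peak :: "real \<Rightarrow> nat \<Rightarrow> complex \<Rightarrow> complex" where
  "peak \<eta> k z = disc_map (exp (- \<eta>)) (z ^ 2 ^ k)"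

definition near_grid :: "nat \<Rightarrow> real \<Rightarrow> real set" where
  "near_grid k h = {t. \<exists>j::int. \<bar>2 ^ k * t - 2 * pi * of_int j\<bar> < h}"

text \<open>
  Off the grid the argument \<open>z ^ 2 ^ k\<close> stays away from 1 along the whole radius, by a distance depending
  on \<open>h\<close> only.  So one bound on \<open>\<eta>\<close> serves every degree, and the degree can be chosen after \<open>\<eta>\<close>.
\<close>

lemma peak_close_to_1_off_grid:
  assumes h: "0 < h" "h \<le> pi" and c: "0 < c"
  obtains \<eta>0 where "0 < \<eta>0"
    and "\<And>\<eta> k x \<rho>. \<lbrakk>0 < \<eta>; \<eta> \<le> \<eta>0; x \<notin> near_grid k h; 0 \<le> \<rho>; \<rho> \<le> 1\<rbrakk>
           \<Longrightarrow> norm (peak \<eta> k (of_real \<rho> * cis x) - 1) \<le> c"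
proof
  define m where "m = sqrt (2 - 2 * cos h)"
  have "cos h < cos 0" using h by (intro cos_monotone_0_pi) auto
  then have m: "0 < m" by (simp add: m_def)
  show "0 < c * m / 4" using c m by simp
  fix \<eta> k x \<rho>
  assume \<eta>: "0 < \<eta>" "\<eta> \<le> c * m / 4" and x: "x \<notin> near_grid k h" and \<rho>: "0 \<le> \<rho>" "\<rho> \<le> (1::real)"
  define a where "a = exp (- \<eta>)"
  define u where "u = cis (2^k * x)"
  have a: "0 \<le> a" "a < 1" "1 - a \<le> \<eta>"
    using \<eta> exp_ge_add_one_self[of "- \<eta>"] by (auto simp: a_def)
  have w: "(of_real \<rho> * cis x) ^ 2^k = of_real (\<rho> ^ 2^k) * u"
    by (simp add: power_mult_distrib Complex.DeMoivre u_def)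
  have \<rho>': "0 \<le> \<rho> ^ 2^k" "\<rho> ^ 2^k \<le> 1" using \<rho> by (auto intro: power_le_one)
  have "m \<le> norm (1 - u)"
    unfolding m_def u_def using x h
    by (intro norm_one_minus_cis_ge) (auto simp: near_grid_def not_less)
  moreover have "norm (1 - u) / 2 \<le> norm (1 - of_real (a * \<rho> ^ 2^k) * u)"
    using a \<rho>' by (intro norm_one_minus_ray_ge) (auto simp: u_def mult_le_one)
  ultimately have den: "m / 2 \<le> norm (1 - of_real a * (of_real (\<rho> ^ 2^k) * u))"
    by (simp add: mult.assoc)
  have "norm (peak \<eta> k (of_real \<rho> * cis x) - 1)
      \<le> 2 * (1 - a) / norm (1 - of_real a * (of_real (\<rho> ^ 2^k) * u))"
    unfolding peak_def w a_def[symmetric] using a \<rho>'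
    by (intro norm_disc_map_minus_1) (auto simp: norm_mult u_def simp del: of_real_power)
  also have "\<dots> \<le> 2 * (c * m / 4) / (m / 2)"
    using den m a \<eta> by (intro frac_le) auto
  also have "\<dots> = c" using m by simp
  finally show "norm (peak \<eta> k (of_real \<rho> * cis x) - 1) \<le> c" .
qed

lemma open_near_grid: "open (near_grid k h)"
proof -
  have "near_grid k h = (\<Union>j::int. {t. \<bar>2 ^ k * t - 2 * pi * of_int j\<bar> < h})"
    by (auto simp: near_grid_def)
  also have "open \<dots>"
    by (intro open_UN ballI open_Collect_less continuous_intros)
  finally show ?thesis .
qed

text \<open>
  A period meets at most \<open>2\<^sup>k + 2\<close> of the intervals around grid points, each of length \<open>2 h / 2\<^sup>k\<close>.  The
  bound does not depend on \<open>k\<close>.  The reflected form \<open>y - u\<close> is the one that occurs in convolutions.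
\<close>

lemma emeasure_near_grid_le:
  assumes h: "0 < h" "h \<le> pi"
  shows "emeasure lebesgue {u \<in> {c..<c + 2 * pi}. y - u \<in> near_grid k h} \<le> ennreal (6 * h)"
proof -
  define N :: real where "N = 2 ^ k"
  have N: "1 \<le> N" by (simp add: N_def)
  define \<alpha> where "\<alpha> = (N * (y - c - 2 * pi) - h) / (2 * pi)"
  define \<beta> where "\<beta> = (N * (y - c) + h) / (2 * pi)"
  define J where "J = {\<lceil>\<alpha>\<rceil>..\<lfloor>\<beta>\<rfloor>}"
  define C where "C j = {(N * y - 2 * pi * of_int j) / N - h / N .. (N * y - 2 * pi * of_int j) / N + h / N}"
    for j :: int
  have "{u \<in> {c..<c + 2 * pi}. y - u \<in> near_grid k h} \<subseteq> (\<Union>j\<in>J. C j)"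
  proof clarsimp
    fix u assume u: "c \<le> u" "u < c + 2 * pi" "y - u \<in> near_grid k h"
    then obtain j :: int where j: "\<bar>N * (y - u) - 2 * pi * of_int j\<bar> < h"
      by (auto simp: near_grid_def N_def)
    have "N * (y - c - 2 * pi) \<le> N * (y - u)" "N * (y - u) \<le> N * (y - c)"
      using u N by (auto intro!: mult_left_mono)
    then have "\<alpha> \<le> of_int j" "of_int j \<le> \<beta>"
      using j by (auto simp: \<alpha>_def \<beta>_def field_simps abs_less_iff)
    then have "j \<in> J" by (auto simp: J_def ceiling_le_iff le_floor_iff)
    moreover have "u \<in> C j"
    proof -
      have "N * y - 2 * pi * of_int j - h \<le> N * u" "N * u \<le> N * y - 2 * pi * of_int j + h"
        using j by (auto simp: abs_less_iff algebra_simps)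
      then show ?thesis
        using N unfolding C_def diff_divide_distrib[symmetric] add_divide_distrib[symmetric]
        by (simp add: divide_le_eq le_divide_eq mult.commute)
    qed
    ultimately show "\<exists>j\<in>J. u \<in> C j" by blast
  qed
  then have "emeasure lebesgue {u \<in> {c..<c + 2 * pi}. y - u \<in> near_grid k h}
      \<le> emeasure lebesgue (\<Union>j\<in>J. C j)"
    by (intro emeasure_mono) (auto simp: J_def C_def)
  also have "\<dots> \<le> (\<Sum>j\<in>J. emeasure lebesgue (C j))"
    by (intro emeasure_subadditive_finite) (auto simp: J_def C_def)
  also have "\<dots> = (\<Sum>j\<in>J. ennreal (2 * h / N))"
    using h N by (intro sum.cong) (auto simp: C_def field_simps)
  also have "\<dots> = ennreal (real (card J) * (2 * h / N))"
    using h N by (subst ennreal_mult) (auto simp: ennreal_of_nat_eq_real_of_nat)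
  also have "\<dots> \<le> ennreal (6 * h)"
  proof (intro ennreal_leI)
    have "\<beta> - \<alpha> = N + h / pi"
      by (simp add: \<alpha>_def \<beta>_def field_simps)
    moreover have "h / pi \<le> 1" using h by simp
    ultimately have "\<beta> - \<alpha> + 1 \<le> 3 * N" using N by linarith
    moreover have "real (card J) \<le> max 0 (\<beta> - \<alpha> + 1)"
      unfolding J_def by simp linarith
    ultimately have "real (card J) \<le> 3 * N" using N by simp
    then have "real (card J) * (2 * h / N) \<le> 3 * N * (2 * h / N)"
      using h N by (intro mult_right_mono) auto
    then show "real (card J) * (2 * h / N) \<le> 6 * h" using N by simp
  qed
  finally show ?thesis .
qed

section \<open>Integration over a period\<close>

lemma set_integral_translate:
  fixes F :: "real \<Rightarrow> 'a :: euclidean_space"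
  shows "(LINT t:{a + s..<b + s}|lebesgue. F t) = (LINT t:{a..<b}|lebesgue. F (t + s))"
proof -
  have "(LINT t:{a + s..<b + s}|lebesgue. F t)
      = (LINT t|lebesgue. indicator {a + s..<b + s} (s + 1 * t) *\<^sub>R F (s + 1 * t))"
    unfolding set_lebesgue_integral_def by (subst lebesgue_integral_real_affine[of 1 _ s]) simp_all
  also have "\<dots> = (LINT t:{a..<b}|lebesgue. F (t + s))"
    unfolding set_lebesgue_integral_def
    by (intro Bochner_Integration.integral_cong) (auto simp: indicator_def add.commute)
  finally show ?thesis .
qed

lemma periodic_shift_int:
  fixes F :: "real \<Rightarrow> 'a"
  assumes "\<And>x. F (x + 2 * pi) = F x"
  shows "F (x + 2 * pi * of_int k) = F x"
proof -
  have *: "F (x + 2 * pi * real n) = F x" for n x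
  proof (induction n)
    case (Suc n)
    have "F (x + 2 * pi * real (Suc n)) = F ((x + 2 * pi * real n) + 2 * pi)"
      by (simp add: algebra_simps)
    then show ?case using assms Suc by simp
  qed simp
  show ?thesis
  proof (cases k)
    case (nonneg n) then show ?thesis using * by simp
  next
    case (neg n)
    then have "of_int k = - real (Suc n)" by simp
    then have "x + 2 * pi * of_int k + 2 * pi * real (Suc n) = x" by (simp only:)
    then show ?thesis using *[of "x + 2 * pi * of_int k" "Suc n"] by metis
  qed
qed

text \<open>
  After a shift by a multiple of \<open>2\<pi>\<close> the interval starts at some \<open>d \<in> [-\<pi>, \<pi>]\<close>; the part of it beyond \<open>\<pi>\<close> is
  moved back by one period.
\<close>

lemma set_integral_over_period:
  fixes F :: "real \<Rightarrow> 'a :: euclidean_space"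
  assumes per: "\<And>x. F (x + 2 * pi) = F x" and int: "\<And>a b. set_integrable lebesgue {a..<b} F"
  shows "(LINT t:{c..<c + 2 * pi}|lebesgue. F t) = (LINT t:circle_dom|lebesgue. F t)"
proof -
  define k where "k = \<lfloor>(c + pi) / (2 * pi)\<rfloor>"
  define d where "d = c - 2 * pi * of_int k"
  have "of_int k \<le> (c + pi) / (2 * pi)" "(c + pi) / (2 * pi) < of_int k + 1"
    unfolding k_def by linarith+
  then have d: "- pi \<le> d" "d \<le> pi" by (auto simp: d_def field_simps)
  note shift = periodic_shift_int[of F, OF per]
  have split: "(LINT t:{a..<b}|lebesgue. F t) = (LINT t:{a..<e}|lebesgue. F t) + (LINT t:{e..<b}|lebesgue. F t)"
    if "a \<le> e" "e \<le> b" for a b e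
  proof -
    have "{a..<b} = {a..<e} \<union> {e..<b}" using that by auto
    then show ?thesis by (simp only:) (intro set_integral_Un int, auto)
  qed
  have "(LINT t:{c..<c + 2 * pi}|lebesgue. F t) = (LINT t:{d..<d + 2 * pi}|lebesgue. F t)"
    using set_integral_translate[of d "2 * pi * of_int k" "d + 2 * pi" F]
    by (simp add: shift d_def)
  also have "\<dots> = (LINT t:{d..<pi}|lebesgue. F t) + (LINT t:{pi..<d + 2 * pi}|lebesgue. F t)"
    using d by (intro split) auto
  also have "(LINT t:{pi..<d + 2 * pi}|lebesgue. F t) = (LINT t:{-pi..<d}|lebesgue. F t)"
    using set_integral_translate[of "-pi" "2 * pi" d F] by (simp add: per)
  finally show ?thesis using split[of "-pi" d pi] d by simp
qed

lemma set_integral_reflect_period: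
  fixes F :: "real \<Rightarrow> 'a :: euclidean_space"
  assumes per: "\<And>x. F (x + 2 * pi) = F x" and int: "\<And>a b. set_integrable lebesgue {a..<b} F"
  shows "(LINT t:circle_dom|lebesgue. F (y - t)) = (LINT t:circle_dom|lebesgue. F t)"
proof -
  have "(LINT t:{y - pi..<(y - pi) + 2 * pi}|lebesgue. F t)
      = (LINT t|lebesgue. indicator {y - pi..<y + pi} (y + (-1) * t) *\<^sub>R F (y + (-1) * t))"
    unfolding set_lebesgue_integral_def
    by (subst lebesgue_integral_real_affine[of "-1" _ y]) (simp_all add: add.commute)
  also have "\<dots> = (LINT t:circle_dom|lebesgue. F (y - t))"
    unfolding set_lebesgue_integral_def
  proof (rule integral_cong_AE)
    have m: "F \<in> borel_measurable lebesgue"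
    proof -
      have "(\<lambda>x. indicator {- real n..<real n} x *\<^sub>R F x) \<in> borel_measurable lebesgue" for n
        using int[of "- real n" "real n"] by (simp add: set_integrable_def borel_measurable_integrable)
      moreover have "(\<lambda>n. indicator {- real n..<real n} x *\<^sub>R F x) \<longlonglongrightarrow> F x" for x
      proof (rule tendsto_eventually)
        obtain n0 where "\<bar>x\<bar> < real n0" using reals_Archimedean2 by blast
        then show "\<forall>\<^sub>F n in sequentially. indicator {- real n..<real n} x *\<^sub>R F x = F x"
          by (intro eventually_sequentiallyI[of n0]) (auto simp: indicator_def)
      qed
      ultimately show ?thesis by (rule borel_measurable_LIMSEQ_metric)
    qed
    have "(\<lambda>t::real. y + (-1) * t) \<in> lebesgue \<rightarrow>\<^sub>M lebesgue"
      using lebesgue_affine_measurable[where c= "\<lambda>x::real. -1" and t = y] by simp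
    from measurable_compose[OF this m] have m': "(\<lambda>t. F (y - t)) \<in> borel_measurable lebesgue" by simp
    show "(\<lambda>t. indicator circle_dom t *\<^sub>R F (y - t)) \<in> borel_measurable lebesgue"
      by (intro borel_measurable_scaleR borel_measurable_indicator m') auto
    have "(\<lambda>t. indicator {- pi<..pi} t *\<^sub>R F (y - t)) \<in> borel_measurable lebesgue"
      by (intro borel_measurable_scaleR borel_measurable_indicator m') auto
    then show "(\<lambda>t. indicator {y - pi..<y + pi} (y + (-1) * t) *\<^sub>R F (y + (-1) * t)) \<in> borel_measurable lebesgue"
      by (rule measurable_cong[THEN iffD1, rotated]) (auto simp: indicator_def)
    have "AE t in lebesgue. t \<noteq> pi \<and> t \<noteq> - pi"
      by (intro AE_conjI AE_not_in[of "{_}", simplified]) auto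
    then show "AE t in lebesgue. indicator {y - pi..<y + pi} (y + (-1) * t) *\<^sub>R F (y + (-1) * t)
        = indicator circle_dom t *\<^sub>R F (y - t)"
      by eventually_elim (auto simp: indicator_def)
  qed
  finally show ?thesis using set_integral_over_period[OF per int] by metis
qed

section \<open>Concentration of the kernels\<close>

lemma Linf_circle_set_integrable:
  fixes f :: "real \<Rightarrow> 'a :: euclidean_space"
  assumes "Linf_circle f"
  shows "set_integrable lebesgue {a..<b} f"
proof -
  obtain C where C: "AE x in lebesgue. norm (f x) \<le> C" and m: "f \<in> borel_measurable lebesgue"
    using assms by (auto simp: Linf_circle_def)
  show ?thesis
    unfolding set_integrable_def
  proof (rule integrableI_bounded_set_indicator[where B = C])
    show "emeasure lebesgue {a..<b} < \<infinity>" by (cases "a \<le> b") auto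
    show "AE x in lebesgue. x \<in> {a..<b} \<longrightarrow> norm (f x) \<le> C" using C by eventually_elim auto
  qed (use m in auto)
qed

lemma Linf_circle_reflected_product:
  assumes \<phi>: "Linf_circle (\<phi> :: real \<Rightarrow> real)"
    and G: "G \<in> borel_measurable borel" "\<And>x. G (x + 2 * pi) = G x" "\<And>x. norm (G x) \<le> 1"
  shows "Linf_circle (\<lambda>u. complex_of_real (\<phi> u) * G (y - u))"
  unfolding Linf_circle_def
proof (intro conjI allI)
  show "complex_of_real (\<phi> (x + 2 * pi)) * G (y - (x + 2 * pi)) = complex_of_real (\<phi> x) * G (y - x)" for x
    using \<phi> G(2)[of "y - (x + 2 * pi)"] by (simp add: Linf_circle_def)
  have "(\<lambda>u. G (y - u)) \<in> borel_measurable borel" using G(1) by measurable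
  then have "(\<lambda>u. G (y - u)) \<in> borel_measurable lebesgue"
    by (intro measurable_completion) simp
  then show "(\<lambda>u. complex_of_real (\<phi> u) * G (y - u)) \<in> borel_measurable lebesgue"
    using \<phi> by (intro borel_measurable_times borel_measurable_of_real) (auto simp: Linf_circle_def)
  obtain C where C: "AE x in lebesgue. norm (\<phi> x) \<le> C" using \<phi> by (auto simp: Linf_circle_def)
  then have "AE x in lebesgue. norm (complex_of_real (\<phi> x) * G (y - x)) \<le> C"
  proof eventually_elim
    case (elim x)
    have "norm (complex_of_real (\<phi> x) * G (y - x)) \<le> norm (\<phi> x) * 1"
      unfolding norm_mult using G(3) by (intro mult_mono) auto
    then show ?case using elim by simp
  qed
  then show "\<exists>C. AE x in lebesgue. norm (complex_of_real (\<phi> x) * G (y - x)) \<le> C" by blast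
qed

text \<open>
  After the substitution \<open>u = y - t\<close>, the integrand \<open>\<phi>(u) |G(y - u) - c|\<close> is at most \<open>\<kappa> \<phi>(u)\<close> in the window and
  off \<open>E\<close>, and at most \<open>2 \<phi>(u)\<close> elsewhere; both \<open>E\<close> and the complement of the window carry little mass.
  Smallness of \<open>E\<close> is measured by \<open>\<phi>\<close>, since a concentrated kernel may see a set of small measure.
\<close>

lemma kernel_average_near_constant:
  fixes \<phi> :: "real \<Rightarrow> real"
  assumes \<phi>: "Linf_circle \<phi>" "\<And>x. 0 \<le> \<phi> x"
    and G: "G \<in> borel_measurable borel" "\<And>x. G (x + 2 * pi) = G x" "\<And>x. norm (G x) \<le> 1"
    and c: "norm (c :: complex) \<le> 1" and \<omega>: "\<omega> \<le> pi"
    and window: "1 - \<epsilon> \<le> (LINT u:{- \<omega><..<\<omega>}|lebesgue. \<phi> u)"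
    and mass: "\<bar>(LINT u:circle_dom|lebesgue. \<phi> u) - 1\<bar> \<le> \<epsilon>"
    and E: "E \<in> sets lebesgue" "E \<subseteq> circle_dom" "(LINT u:E|lebesgue. \<phi> u) \<le> \<epsilon>"
    and near: "\<And>u. u \<in> {- \<omega><..<\<omega>} \<Longrightarrow> u \<notin> E \<Longrightarrow> norm (G (y - u) - c) \<le> \<kappa>"
    and \<kappa>: "0 \<le> \<kappa>"
  shows "norm ((LINT t:circle_dom|lebesgue. complex_of_real (\<phi> (y - t)) * G t) - c)
    \<le> (1 + \<epsilon>) * \<kappa> + 7 * \<epsilon>"
proof -
  define M where "M = (LINT u:circle_dom|lebesgue. \<phi> u)"
  define W where "W = {- \<omega><..<\<omega>}"
  have W: "W \<in> sets lebesgue" "W \<subseteq> circle_dom" using \<omega> by (auto simp: W_def)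
  define F where "F u = complex_of_real (\<phi> u) * G (y - u)" for u
  have F: "Linf_circle F" unfolding F_def by (rule Linf_circle_reflected_product[OF \<phi>(1) G])
  have int\<phi>: "set_integrable lebesgue circle_dom \<phi>" and intF: "set_integrable lebesgue circle_dom F"
    using Linf_circle_set_integrable[OF \<phi>(1)] Linf_circle_set_integrable[OF F] by blast+
  have int\<phi>E: "set_integrable lebesgue E \<phi>" and int\<phi>W: "set_integrable lebesgue W \<phi>"
    using set_integrable_subset[OF int\<phi>] E W by blast+
  have "(LINT t:circle_dom|lebesgue. complex_of_real (\<phi> (y - t)) * G t) = (LINT t:circle_dom|lebesgue. F (y - t))"
    by (simp add: F_def)
  also have "\<dots> = (LINT t:circle_dom|lebesgue. F t)"
    using F by (intro set_integral_reflect_period Linf_circle_set_integrable) (auto simp: Linf_circle_def)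
  finally have refl: "(LINT t:circle_dom|lebesgue. complex_of_real (\<phi> (y - t)) * G t)
      = (LINT t:circle_dom|lebesgue. F t)" .
  have intc: "set_integrable lebesgue circle_dom (\<lambda>u. complex_of_real (\<phi> u) * c)"
    by (rule Linf_circle_set_integrable[OF Linf_circle_reflected_product[OF \<phi>(1), where G = "\<lambda>_. c"]])
       (use c in auto)
  have "(LINT u:circle_dom|lebesgue. complex_of_real (\<phi> u) * c) = of_real M * c"
    unfolding M_def by (simp add: set_integral_complex_of_real)
  then have diff: "(LINT u:circle_dom|lebesgue. F u) - of_real M * c
      = (LINT u:circle_dom|lebesgue. F u - complex_of_real (\<phi> u) * c)"
    using set_integral_diff(2)[OF intF intc] by (simp only:)
  \<comment> \<open>On the window, outside \<open>E\<close>, the right-hand integrand is \<open>\<kappa> \<phi>\<close>; elsewhere in the period it is at least \<open>2 \<phi>\<close>.\<close>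
  have bound: "norm (\<integral>u. indicator circle_dom u *\<^sub>R (F u - complex_of_real (\<phi> u) * c) \<partial>lebesgue)
      \<le> (\<integral>u. (\<kappa> + 2) * (indicator circle_dom u *\<^sub>R \<phi> u) + 2 * (indicator E u *\<^sub>R \<phi> u)
            - 2 * (indicator W u *\<^sub>R \<phi> u) \<partial>lebesgue)"
  proof (rule order_trans[OF integral_norm_bound Bochner_Integration.integral_mono])
    show "integrable lebesgue (\<lambda>u. norm (indicator circle_dom u *\<^sub>R (F u - complex_of_real (\<phi> u) * c)))"
      using integrable_norm[OF set_integral_diff(1)[OF intF intc, unfolded set_integrable_def]] .
    show "integrable lebesgue (\<lambda>u. (\<kappa> + 2) * (indicator circle_dom u *\<^sub>R \<phi> u) + 2 * (indicator E u *\<^sub>R \<phi> u)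
            - 2 * (indicator W u *\<^sub>R \<phi> u))"
      using int\<phi> int\<phi>E int\<phi>W unfolding set_integrable_def
      by (intro Bochner_Integration.integrable_diff Bochner_Integration.integrable_add integrable_mult_right)
    fix u
    show "norm (indicator circle_dom u *\<^sub>R (F u - complex_of_real (\<phi> u) * c))
      \<le> (\<kappa> + 2) * (indicator circle_dom u *\<^sub>R \<phi> u) + 2 * (indicator E u *\<^sub>R \<phi> u)
            - 2 * (indicator W u *\<^sub>R \<phi> u)"
    proof (cases "u \<in> circle_dom")
      case False
      then have "u \<notin> E" "u \<notin> W" using E W by auto
      then show ?thesis using False by simp
    next
      case True
      have eq: "norm (F u - complex_of_real (\<phi> u) * c) = \<phi> u * norm (G (y - u) - c)"
        using \<phi>(2)[of u] by (simp add: F_def norm_mult flip: right_diff_distrib)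
      have "norm (G (y - u) - c) \<le> 2"
        using norm_triangle_ineq4[of "G (y - u)" c] c G(3)[of "y - u"] by linarith
      then have "norm (G (y - u) - c) \<le> (\<kappa> + 2) + 2 * indicator E u - 2 * indicator W u"
        using near[of u] \<kappa> by (auto simp: indicator_def W_def)
      from mult_left_mono[OF this \<phi>(2)[of u]]
      have "norm (F u - complex_of_real (\<phi> u) * c)
          \<le> \<phi> u * ((\<kappa> + 2) + 2 * indicator E u - 2 * indicator W u)"
        by (simp only: eq)
      then show ?thesis using True by (simp add: algebra_simps)
    qed
  qed
  also have "\<dots> = (\<kappa> + 2) * M + 2 * (LINT u:E|lebesgue. \<phi> u) - 2 * (LINT u:W|lebesgue. \<phi> u)"
    using int\<phi> int\<phi>E int\<phi>W unfolding set_integrable_def M_def set_lebesgue_integral_def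
    by (subst Bochner_Integration.integral_diff Bochner_Integration.integral_add integral_mult_right_zero;
        (intro Bochner_Integration.integrable_diff Bochner_Integration.integrable_add integrable_mult_right)?)+
       simp_all
  also have "\<dots> \<le> (\<kappa> + 2) * (1 + \<epsilon>) + 2 * \<epsilon> - 2 * (1 - \<epsilon>)"
    using \<kappa> mass E window unfolding M_def[symmetric] W_def[symmetric]
    by (intro diff_mono add_mono mult_left_mono) auto
  finally have 1: "norm ((LINT u:circle_dom|lebesgue. F u) - of_real M * c) \<le> (1 + \<epsilon>) * \<kappa> + 6 * \<epsilon>"
    unfolding diff unfolding set_lebesgue_integral_def by (rule order_trans) (simp add: algebra_simps)
  have "norm (of_real M * c - c) = \<bar>M - 1\<bar> * norm c"
    by (simp add: left_diff_distrib norm_mult[symmetric] flip: norm_of_real[where 'a = complex])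
  also have "\<dots> \<le> \<epsilon> * 1" using mass c unfolding M_def by (intro mult_mono) auto
  finally have "norm (of_real M * c - c) \<le> \<epsilon>" by simp
  with 1 show ?thesis
    unfolding refl using norm_triangle_ineq[of "(LINT u:circle_dom|lebesgue. F u) - of_real M * c" "of_real M * c - c"]
    by simp
qed

text \<open>
  A limit superior equal to 1 provides some \<open>d < \<delta>\<close> for which the windows \<open>d \<lambda>(r)\<close> eventually carry mass
  above \<open>1 - \<epsilon>\<close>, and the larger windows \<open>\<delta> \<lambda>(r)\<close> carry at least as much.  Positivity of \<open>\<lambda>(r)\<close> comes from the
  orientation of the integral: for \<open>\<lambda>(r) \<le> 0\<close> it would not be positive.
\<close>

lemma Pi_star_concentration:
  assumes Linf: "\<And>r. 0 < r \<Longrightarrow> r < 1 \<Longrightarrow> Linf_circle (\<phi> r)" and pos: "Phi4 \<phi>"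
    and Pi: "Pi_star l \<phi> = 1" and \<delta>: "0 < \<delta>" and \<epsilon>: "0 < \<epsilon>"
  shows "\<forall>\<^sub>F r in at_left 1. 0 < l r \<and> 1 - \<epsilon> < (LINT u:{- (\<delta> * l r)<..<\<delta> * l r}|lebesgue. \<phi> r u)"
proof -
  \<comment> \<open>Keeping \<open>1 - e\<close> positive is what forces \<open>l r > 0\<close> below.\<close>
  define e where "e = min \<epsilon> (1/2)"
  define I where "I d r = (LINT t=ereal (- d * l r)..ereal (d * l r)|lebesgue. \<phi> r t)" for d r
  have "\<exists>d. 0 < d \<and> d < \<delta> \<and> ereal (1 - e) < Liminf (at_left 1) (\<lambda>r. ereal (I d r))"
  proof (rule ccontr)
    assume *: "\<not> ?thesis"
    have "\<forall>\<^sub>F d in at_right 0. d \<in> {0<..<\<delta>}" by (rule eventually_at_right_real[OF \<delta>])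
    then have "\<forall>\<^sub>F d in at_right 0. Liminf (at_left 1) (\<lambda>r. ereal (I d r)) \<le> ereal (1 - e)"
    proof eventually_elim
      case (elim d)
      then have "0 < d" "d < \<delta>" by auto
      then show ?case using * by (meson not_less)
    qed
    then have "Pi_star l \<phi> \<le> ereal (1 - e)" unfolding Pi_star_def I_def by (rule Limsup_bounded)
    then show False using Pi \<epsilon> by (simp add: e_def)
  qed
  then obtain d where d: "0 < d" "d < \<delta>" "ereal (1 - e) < Liminf (at_left 1) (\<lambda>r. ereal (I d r))"
    by blast
  then have "\<forall>\<^sub>F r in at_left 1. ereal (1 - e) < ereal (I d r)"
    by (intro less_LiminfD)
  moreover have "\<forall>\<^sub>F r in at_left 1. r \<in> {0<..<(1::real)}" by (rule eventually_at_left_real) simp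
  ultimately show ?thesis
  proof eventually_elim
    case (elim r)
    then have Id: "1 - e < I d r" and r: "0 < r" "r < 1" by auto
    have nonneg: "0 \<le> (LINT u:A|lebesgue. \<phi> r u)" for A
      unfolding set_lebesgue_integral_def using pos r by (intro Bochner_Integration.integral_nonneg) (auto simp: Phi4_def)
    have l: "0 < l r"
    proof (rule ccontr)
      assume "\<not> 0 < l r"
      then have "d * l r \<le> 0" using d(1) by (simp add: mult_le_0_iff)
      then have "I d r \<le> 0"
        using nonneg by (auto simp: I_def interval_lebesgue_integral_def set_lebesgue_integral_def)
      then show False using Id by (simp add: e_def)
    qed
    define L where "L = \<delta> * l r"
    have "d * l r \<le> L" unfolding L_def using d l by (intro mult_right_mono) auto
    then have sub: "{- (d * l r)<..<d * l r} \<subseteq> {- L<..<L}" by auto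
    have int: "set_integrable lebesgue {- L<..<L} (\<phi> r)"
      by (rule set_integrable_subset[OF Linf_circle_set_integrable[OF Linf[OF r], of "-L" L]]) auto
    have "I d r = (LINT u:{- (d * l r)<..<d * l r}|lebesgue. \<phi> r u)"
      using d l by (simp add: I_def interval_lebesgue_integral_def)
    also have "\<dots> \<le> (LINT u:{- L<..<L}|lebesgue. \<phi> r u)"
      using int set_integrable_subset[OF int _ sub] sub pos r
      unfolding set_lebesgue_integral_def set_integrable_def
      by (intro Bochner_Integration.integral_mono) (auto simp: indicator_def Phi4_def)
    finally show ?case using Id l by (simp add: L_def e_def)
  qed
qed

section \<open>One stage of the construction\<close>

lemma eventually_at_left_1D:
  assumes "\<forall>\<^sub>F r in at_left (1::real). P r"
  obtains b where "b < 1" "\<And>r. b < r \<Longrightarrow> r < 1 \<Longrightarrow> P r"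
  using assms by (auto simp: eventually_at_left[of 0 1])

text \<open>
  One stage: \<open>q\<close> is the boundary value of the product so far, \<open>d\<close> the tolerance that the earlier stages leave
  for the new exceptional set, and \<open>d'\<close> the one that this stage leaves for later exceptional sets.  The
  last conclusion is stated for an arbitrary \<open>G\<close> close to the new product off a small set, because the
  final function is known only after all the stages.

  For a grid point and for a midpoint at distance \<open>s \<in> [2\<pi>/N, 4\<pi>/N]\<close> to the right of \<open>x\<close>, the intermediate
  value theorem gives \<open>r\<close> with \<open>\<lambda>(r) = s\<close>.  The kernel average at \<open>x + s\<close> is then close to \<open>-q x\<close> and to \<open>q x\<close>
  respectively, and these two values have distance 2.
\<close>

lemma oscillation_stage:
  fixes \<phi> :: "real \<Rightarrow> real \<Rightarrow> real" and l :: "real \<Rightarrow> real" and q :: "real \<Rightarrow> complex"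
  assumes Linf: "\<And>r. 0 < r \<Longrightarrow> r < 1 \<Longrightarrow> Linf_circle (\<phi> r)"
    and Phi: "Phi1 \<phi>" "Phi4 \<phi>" "Phi5 \<phi>"
    and l: "continuous_on {0..1} l" "l 1 = 0"
    and Pi: "Pi_star l \<phi> = 1"
    and q: "uniformly_continuous_on UNIV q" "\<And>t. norm (q t) = 1"
    and d: "0 < d" "d \<le> 1" and c: "0 < c" and r0: "r0 < 1"
  obtains \<eta> k d' where "0 < \<eta>" "\<eta> \<le> d" "0 < d'" "d' \<le> d / 2"
    and "\<And>x \<rho>. \<lbrakk>x \<notin> near_grid k d; 0 \<le> \<rho>; \<rho> \<le> 1\<rbrakk> \<Longrightarrow> norm (peak \<eta> k (of_real \<rho> * cis x) - 1) \<le> c"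
    and "\<And>G E x. \<lbrakk>G \<in> borel_measurable borel; \<And>t. G (t + 2 * pi) = G t; \<And>t. norm (G t) \<le> 1;
           open E; \<And>y. emeasure lebesgue {u \<in> circle_dom. y - u \<in> E} \<le> ennreal (12 * d');
           \<And>t. t \<notin> E \<Longrightarrow> norm (G t - q t * peak \<eta> k (cis t)) \<le> 1 / 100\<rbrakk>
         \<Longrightarrow> \<exists>r r'. r0 < r \<and> r < 1 \<and> r0 < r' \<and> r' < 1 \<and>
               1 \<le> norm (kernel_integral \<phi> r (x + l r) G - kernel_integral \<phi> r' (x + l r') G)"
proof -
  obtain \<eta>0 where \<eta>0: "0 < \<eta>0"
    "\<And>\<eta> k x \<rho>. \<lbrakk>0 < \<eta>; \<eta> \<le> \<eta>0; x \<notin> near_grid k d; 0 \<le> \<rho>; \<rho> \<le> 1\<rbrakk>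
           \<Longrightarrow> norm (peak \<eta> k (of_real \<rho> * cis x) - 1) \<le> c"
  proof (rule peak_close_to_1_off_grid[of d c])
    show "d \<le> pi" using d pi_gt3 by simp
  qed (use d c in blast)+
  define \<eta> where "\<eta> = min d \<eta>0"
  have \<eta>: "0 < \<eta>" "\<eta> \<le> d" "\<eta> \<le> \<eta>0" using d \<eta>0 by (auto simp: \<eta>_def)
  define a where "a = exp (- \<eta>)"
  have a: "0 \<le> a" "a < 1" using \<eta> by (auto simp: a_def)
  define K where "K = 2 / (1 - a)"
  have K: "0 < K" using a by (simp add: K_def)
  \<comment> \<open>As a function of \<open>N t\<close> the new factor is \<open>K\<close>-Lipschitz, and \<open>N t\<close> varies by at most \<open>4\<pi> \<delta>\<close> on either side of
    the centre of the window; it changes there by at most 1/100.\<close>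
  define \<delta> where "\<delta> = min 1 (1 / (400 * pi * K))"
  have \<delta>: "0 < \<delta>" "\<delta> \<le> 1" "K * (4 * pi * \<delta>) \<le> 1 / 100"
  proof -
    show "0 < \<delta>" "\<delta> \<le> 1" using K by (auto simp: \<delta>_def)
    have "K * (4 * pi * \<delta>) \<le> K * (4 * pi * (1 / (400 * pi * K)))"
      using K by (intro mult_left_mono) (auto simp: \<delta>_def)
    then show "K * (4 * pi * \<delta>) \<le> 1 / 100" using K by simp
  qed
  have "((\<lambda>r. l r) \<longlongrightarrow> l 1) (at 1 within {0..1})"
    using l(1) unfolding continuous_on_def by force
  then have l0: "(l \<longlongrightarrow> 0) (at_left 1)"
    by (simp add: at_within_Icc_at_left l(2))
  have "\<forall>\<^sub>F r in at_left 1. 0 < l r \<and> 1 - 1/100 < (LINT u:{- (\<delta> * l r)<..<\<delta> * l r}|lebesgue. \<phi> r u)"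
    by (rule Pi_star_concentration[OF Linf Phi(2) Pi \<delta>(1)]) auto
  moreover have "\<forall>\<^sub>F r in at_left 1. \<bar>(LINT u:circle_dom|lebesgue. \<phi> r u) - 1\<bar> < 1/100"
    using tendstoD[OF Phi(1)[unfolded Phi1_def], of "1/100"] by (simp add: dist_real_def)
  moreover have "\<forall>\<^sub>F r in at_left 1. l r < pi" using order_tendstoD(2)[OF l0] by simp
  moreover have "\<forall>\<^sub>F r in at_left 1. r \<in> {max r0 0<..<1}" using r0 by (intro eventually_at_left_real) auto
  ultimately have "\<forall>\<^sub>F r in at_left 1. (0 < l r \<and> 1 - 1/100 < (LINT u:{- (\<delta> * l r)<..<\<delta> * l r}|lebesgue. \<phi> r u))
      \<and> \<bar>(LINT u:circle_dom|lebesgue. \<phi> r u) - 1\<bar> < 1/100 \<and> l r < pi \<and> r \<in> {max r0 0<..<1}"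
    by eventually_elim blast
  then obtain b where b: "b < 1" and P: "\<And>r. b < r \<Longrightarrow> r < 1 \<Longrightarrow>
      (0 < l r \<and> 1 - 1/100 < (LINT u:{- (\<delta> * l r)<..<\<delta> * l r}|lebesgue. \<phi> r u))
      \<and> \<bar>(LINT u:circle_dom|lebesgue. \<phi> r u) - 1\<bar> < 1/100 \<and> l r < pi \<and> r \<in> {max r0 0<..<1}"
    by (rule eventually_at_left_1D) blast
  define r1 where "r1 = (b + 1) / 2"
  have r1: "b < r1" "r1 < 1" using b by (auto simp: r1_def)
  have lr1: "0 < l r1" and r1_pos: "0 < r1" using P[OF r1] by auto
  obtain e where e: "0 < e" "\<And>t x. \<bar>t - x\<bar> < e \<Longrightarrow> norm (q t - q x) < 1/100"
    using q(1)[unfolded uniformly_continuous_on_def dist_norm, rule_format, of "1/100"] by auto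
  obtain k where k: "max (4 * pi / l r1) (8 * pi / e) < 2 ^ k"
    using real_arch_pow[of 2 "max (4 * pi / l r1) (8 * pi / e)"] by force
  define N :: real where "N = 2 ^ k"
  have N: "0 < N" "4 * pi / N \<le> l r1" "8 * pi / N < e"
    using k lr1 e(1) by (auto simp: N_def field_simps)
  have "\<forall>\<^sub>F r in at_left 1. l r < 2 * pi / N" using order_tendstoD(2)[OF l0] N(1) by simp
  then obtain b2 where b2: "b2 < 1" "\<And>r. b2 < r \<Longrightarrow> r < 1 \<Longrightarrow> l r < 2 * pi / N"
    by (rule eventually_at_left_1D) blast
  \<comment> \<open>The scales \<open>\<lambda>(r) \<ge> 2\<pi>/N\<close> of this stage occur only for \<open>r < \<tau>\<close>, so \<open>\<Phi>5\<close> applies uniformly.\<close>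
  define \<tau> where "\<tau> = max r1 ((b2 + 1) / 2)"
  have \<tau>: "0 < \<tau>" "\<tau> < 1" "\<And>r. \<tau> \<le> r \<Longrightarrow> r < 1 \<Longrightarrow> l r < 2 * pi / N"
    using b2 r1 r1_pos by (auto simp: \<tau>_def)
  obtain \<delta>5 where \<delta>5: "0 < \<delta>5" "\<And>r e. \<lbrakk>0 < r; r < \<tau>; e \<in> sets lebesgue; e \<subseteq> circle_dom; measure lebesgue e < \<delta>5\<rbrakk>
      \<Longrightarrow> (LINT t:e|lebesgue. \<phi> r t) < 1/100"
    using Phi(3)[unfolded Phi5_def, rule_format, of "1/100" \<tau>] \<tau> by auto
  \<comment> \<open>Later exceptional sets get total measure at most \<open>12 d'\<close>, strictly below the bound from \<open>\<Phi>5\<close>.\<close>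
  define d' where "d' = min (d / 2) (\<delta>5 / 13)"
  have d': "0 < d'" "d' \<le> d / 2" "12 * d' < \<delta>5" using d \<delta>5(1) by (auto simp: d'_def)
  show thesis
  proof (rule that[of \<eta> d' k])
    show "0 < \<eta>" "\<eta> \<le> d" "0 < d'" "d' \<le> d / 2" by (fact \<eta> d')+
    show "norm (peak \<eta> k (of_real \<rho> * cis x) - 1) \<le> c"
      if "x \<notin> near_grid k d" "0 \<le> \<rho>" "\<rho> \<le> 1" for x \<rho>
      using \<eta>0(2)[OF \<eta>(1,3)] that by blast
    fix G :: "real \<Rightarrow> complex" and E x
    assume G: "G \<in> borel_measurable borel" "\<And>t. G (t + 2 * pi) = G t" "\<And>t. norm (G t) \<le> 1"
      and E: "open E" "\<And>y. emeasure lebesgue {u \<in> circle_dom. y - u \<in> E} \<le> ennreal (12 * d')"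
      and near: "\<And>t. t \<notin> E \<Longrightarrow> norm (G t - q t * peak \<eta> k (cis t)) \<le> 1 / 100"
    \<comment> \<open>The values for \<open>\<theta> = 0\<close> and \<open>\<theta> = \<pi>\<close> have distance 2, so errors of 1/4 leave a gap above 1.\<close>
    have hit: "\<exists>r>r0. r < 1 \<and> norm (kernel_integral \<phi> r (x + l r) G - q x * disc_map a (cis \<theta>)) \<le> 1 / 4"
      if \<theta>: "0 \<le> \<theta>" "\<theta> \<le> pi" for \<theta>
    proof -
      \<comment> \<open>The point \<open>(2\<pi> m + \<theta>) / N\<close> is the first \<open>t \<ge> x + 2\<pi>/N\<close> with \<open>cis (N t) = cis \<theta>\<close>.\<close>
      define m where "m = \<lceil>(N * x + 2 * pi - \<theta>) / (2 * pi)\<rceil>"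
      have "(N * x + 2 * pi - \<theta>) / (2 * pi) \<le> of_int m" "of_int m < (N * x + 2 * pi - \<theta>) / (2 * pi) + 1"
        unfolding m_def by linarith+
      then have m: "N * x + 2 * pi \<le> 2 * pi * of_int m + \<theta>" "2 * pi * of_int m + \<theta> < N * x + 4 * pi"
        by (auto simp: field_simps)
      define s where "s = (2 * pi * of_int m + \<theta>) / N - x"
      have s: "2 * pi / N \<le> s" "s \<le> 4 * pi / N"
      proof -
        have "s = (2 * pi * of_int m + \<theta> - N * x) / N" using N(1) by (simp add: s_def field_simps)
        then show "2 * pi / N \<le> s" "s \<le> 4 * pi / N"
          using m N(1) by (simp_all only:) (intro divide_right_mono; simp)+
      qed
      have s_pos: "0 < s" using s(1) N(1) by (meson divide_pos_pos less_le_trans pi_gt_zero zero_less_numeral mult_pos_pos)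
      have "\<exists>r\<ge>r1. r \<le> 1 \<and> l r = s"
        using s s_pos N l r1 r1_pos by (intro IVT2') (auto elim: continuous_on_subset)
      then obtain r where r: "r1 \<le> r" "r \<le> 1" "l r = s" by blast
      then have r_less: "r < 1" using l(2) s_pos by (cases "r = 1") auto
      have "b < r" using r(1) r1 by simp
      note Pr = P[OF this r_less, unfolded r(3)]
      have r_tau: "r < \<tau>" using \<tau>(3)[OF _ r_less] s(1) r(3) by force
      have r_pos: "0 < r" "r0 < r" using Pr by auto
      define y where "y = x + s"
      define Ey where "Ey = {u \<in> circle_dom. y - u \<in> E}"
      have Ey: "Ey \<in> sets lebesgue" "Ey \<subseteq> circle_dom"
      proof -
        have "Ey = circle_dom \<inter> (\<lambda>u. y - u) -` E" by (auto simp: Ey_def)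
        moreover have "open ((\<lambda>u. y - u) -` E)" using E(1) by (intro open_vimage continuous_intros)
        ultimately show "Ey \<in> sets lebesgue" by auto
      qed (auto simp: Ey_def)
      have "measure lebesgue Ey \<le> 12 * d'"
        using E(2)[of y] d'(1) unfolding Ey_def measure_def by (simp add: enn2real_leI)
      then have Ey_small: "(LINT u:Ey|lebesgue. \<phi> r u) < 1/100"
        using \<delta>5(2)[OF r_pos(1) r_tau Ey] d'(3) by simp
      have "norm ((LINT t:circle_dom|lebesgue. complex_of_real (\<phi> r (y - t)) * G t) - q x * disc_map a (cis \<theta>))
        \<le> (1 + 1/100) * (3/100) + 7 * (1/100)"
      proof (rule kernel_average_near_constant[where \<omega> = "\<delta> * s" and E = Ey])
        show "Linf_circle (\<phi> r)" by (rule Linf[OF r_pos(1) r_less])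
        show "0 \<le> \<phi> r x" for x using Phi(2) r_pos r_less by (auto simp: Phi4_def)
        show "norm (q x * disc_map a (cis \<theta>)) \<le> 1"
          using norm_disc_map_eq_1[OF a, of "cis \<theta>"] q(2) by (simp add: norm_mult)
        have "s < pi" using Pr by blast
        have \<delta>s: "\<delta> * s \<le> s" using mult_right_mono[of \<delta> 1 s] \<delta> s_pos by simp
        then show \<delta>s_pi: "\<delta> * s \<le> pi" using \<open>s < pi\<close> by linarith
        show "1 - 1/100 \<le> (LINT u:{- (\<delta> * s)<..<\<delta> * s}|lebesgue. \<phi> r u)" using Pr by simp
        show "\<bar>(LINT u:circle_dom|lebesgue. \<phi> r u) - 1\<bar> \<le> 1/100" using Pr by simp
        show "(LINT u:Ey|lebesgue. \<phi> r u) \<le> 1/100" using Ey_small by simp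
        fix u assume u: "u \<in> {- (\<delta> * s)<..<\<delta> * s}" "u \<notin> Ey"
        define t where "t = y - u"
        have "u \<in> circle_dom" using u(1) \<delta>s_pi by auto
        then have "t \<notin> E" using u(2) by (auto simp: Ey_def t_def)
        then have 1: "norm (G t - q t * peak \<eta> k (cis t)) \<le> 1/100" by (rule near)
        have "\<bar>u\<bar> < \<delta> * s" using u(1) by auto
        then have "\<bar>u\<bar> \<le> s" using \<delta>s by linarith
        then have "\<bar>t - x\<bar> \<le> 2 * (4 * pi / N)" using s s_pos by (simp add: t_def y_def)
        also have "\<dots> < e" using N(3) by simp
        finally have 2: "norm (q t - q x) < 1/100" by (rule e(2))
        have pk: "peak \<eta> k (cis t) = disc_map a (cis (N * t))"
          by (simp add: peak_def a_def Complex.DeMoivre N_def)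
        have "N * y = \<theta> + 2 * pi * of_int m" using N(1) by (simp add: y_def s_def)
        then have "cis (N * y) = cis \<theta>"
          by (simp add: cis_mult[symmetric] cis_multiple_2pi)
        then have "norm (disc_map a (cis (N * t)) - disc_map a (cis \<theta>)) \<le> K * norm (cis (N * t) - cis (N * y))"
          unfolding K_def using disc_map_lipschitz[OF a, of "cis (N * t)" "cis (N * y)"] by simp
        also have "\<dots> \<le> K * \<bar>N * t - N * y\<bar>"
          using K norm_cis_diff_le by (intro mult_left_mono) auto
        also have "\<bar>N * t - N * y\<bar> = N * \<bar>u\<bar>"
          using N(1) by (simp add: t_def abs_mult flip: right_diff_distrib)
        also have "K * (N * \<bar>u\<bar>) \<le> K * (N * (\<delta> * (4 * pi / N)))"
        proof -
          have "\<bar>u\<bar> \<le> \<delta> * s" using u(1) by auto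
          also have "\<dots> \<le> \<delta> * (4 * pi / N)" using \<delta> s by (intro mult_left_mono) auto
          finally show ?thesis using K N by (intro mult_left_mono) auto
        qed
        also have "\<dots> \<le> 1/100" using \<delta>(3) N(1) by (simp add: mult_ac)
        finally have 3: "norm (disc_map a (cis (N * t)) - disc_map a (cis \<theta>)) \<le> 1/100" .
        have "G t - q x * disc_map a (cis \<theta>)
            = (G t - q t * peak \<eta> k (cis t)) + (q t - q x) * disc_map a (cis (N * t))
              + q x * (disc_map a (cis (N * t)) - disc_map a (cis \<theta>))"
          unfolding pk by (simp add: algebra_simps)
        also have "norm \<dots> \<le> 1/100 + 1/100 + 1/100"
        proof (intro norm_triangle_mono)
          show "norm ((q t - q x) * disc_map a (cis (N * t))) \<le> 1/100"
            using 2 norm_disc_map_eq_1[OF a, of "cis (N * t)"] by (simp add: norm_mult)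
          show "norm (q x * (disc_map a (cis (N * t)) - disc_map a (cis \<theta>))) \<le> 1/100"
            using 3 q(2) by (simp add: norm_mult)
        qed (fact 1)
        finally show "norm (G (y - u) - q x * disc_map a (cis \<theta>)) \<le> 3/100" by (simp add: t_def)
      qed (use G Ey in auto)
      then have "norm (kernel_integral \<phi> r (x + l r) G - q x * disc_map a (cis \<theta>)) \<le> 1 / 4"
        by (simp add: kernel_integral_def r(3) y_def)
      then show ?thesis using r_pos r_less by blast
    qed
    obtain r where r: "r0 < r" "r < 1" "norm (kernel_integral \<phi> r (x + l r) G - q x * disc_map a (cis 0)) \<le> 1 / 4"
      using hit[of 0] by auto
    obtain r' where r': "r0 < r'" "r' < 1" "norm (kernel_integral \<phi> r' (x + l r') G - q x * disc_map a (cis pi)) \<le> 1 / 4"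
      using hit[of pi] by auto
    have "of_real a + 1 \<noteq> (0::complex)" "1 - of_real a \<noteq> (0::complex)"
      using a by (auto simp: complex_eq_iff)
    then have "disc_map a (cis 0) = - 1" "disc_map a (cis pi) = 1"
      by (simp_all add: disc_map_def divide_eq_eq eq_divide_eq add.commute)
    with r(3) r'(3) have A: "norm (kernel_integral \<phi> r (x + l r) G + q x) \<le> 1 / 4"
      "norm (kernel_integral \<phi> r' (x + l r') G - q x) \<le> 1 / 4" by simp_all
    define A B where "A = kernel_integral \<phi> r (x + l r) G" and "B = kernel_integral \<phi> r' (x + l r') G"
    have "2 = norm (2 * q x)" using q(2) by (simp add: norm_mult)
    also have "2 * q x = (A + q x) - (B - q x) - (A - B)" by simp
    also have "norm \<dots> \<le> 1/4 + 1/4 + norm (A - B)"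
      using A norm_triangle_ineq4[of "(A + q x) - (B - q x)" "A - B"] norm_triangle_ineq4[of "A + q x" "B - q x"]
      unfolding A_def[symmetric] B_def[symmetric] by linarith
    finally have "1 \<le> norm (A - B)" by simp
    then show "\<exists>r r'. r0 < r \<and> r < 1 \<and> r0 < r' \<and> r' < 1 \<and>
        1 \<le> norm (kernel_integral \<phi> r (x + l r) G - kernel_integral \<phi> r' (x + l r') G)"
      using r r' unfolding A_def B_def by blast
  qed
qed

section \<open>Infinite products of peaks\<close>

lemma geometric_increments:
  fixes P :: "nat \<Rightarrow> complex"
  assumes "\<And>m. n \<le> m \<Longrightarrow> norm (P (Suc m) - P m) \<le> c / 2 ^ m"
  shows "convergent P" and "norm (lim P - P n) \<le> 2 * c / 2 ^ n"
proof -
  define g where "g m = P (Suc (m + n)) - P (m + n)" for m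
  define G where "G m = c / 2 ^ n * (1 / 2) ^ m" for m :: nat
  have gG: "norm (g m) \<le> G m" for m
    using assms[of "m + n"] by (simp add: g_def G_def power_add power_divide field_simps)
  have sG: "G sums (c / 2 ^ n * (1 / (1 - 1 / 2)))"
    unfolding G_def by (intro sums_mult geometric_sums) simp
  have sg: "summable g" by (rule summable_comparison_test'[OF sums_summable[OF sG]]) (rule gG)
  have "(\<Sum>i<m. g i) = P (m + n) - P n" for m
    using sum_lessThan_telescope[of "\<lambda>i. P (i + n)" m] by (simp add: g_def)
  then have "(\<lambda>m. P (m + n) - P n) \<longlonglongrightarrow> suminf g"
    using summable_LIMSEQ[OF sg] by simp
  from tendsto_add[OF this tendsto_const[of "P n"]]
  have "(\<lambda>m. P (m + n)) \<longlonglongrightarrow> suminf g + P n" by simp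
  then have lim: "P \<longlonglongrightarrow> suminf g + P n" by (rule LIMSEQ_offset)
  then show "convergent P" by (auto simp: convergent_def)
  have "norm (suminf g) \<le> suminf G" by (rule norm_suminf_le[OF gG sums_summable[OF sG]])
  also have "\<dots> = 2 * c / 2 ^ n" using sums_unique[OF sG] by (simp add: mult.commute)
  finally show "norm (lim P - P n) \<le> 2 * c / 2 ^ n" using limI[OF lim] by simp
qed

lemma norm_peak_le_1:
  assumes "0 < \<eta>" "norm z \<le> 1"
  shows "norm (peak \<eta> k z) \<le> 1"
  unfolding peak_def using assms by (intro norm_disc_map_le_1) (auto simp: norm_power power_le_one)

lemma norm_peak_cis:
  assumes "0 < \<eta>"
  shows "norm (peak \<eta> k (cis t)) = 1"
  unfolding peak_def using assms by (intro norm_disc_map_eq_1) (auto simp: norm_power)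

lemma continuous_on_peak:
  assumes "0 < \<eta>" "continuous_on S f" "\<And>s. s \<in> S \<Longrightarrow> norm (f s) \<le> 1"
  shows "continuous_on S (\<lambda>s. peak \<eta> k (f s))"
  unfolding peak_def using assms
  by (intro continuous_on_disc_map continuous_intros) (auto simp: norm_power power_le_one)

lemma uniformly_continuous_mult_peak:
  assumes "0 < \<eta>" and q: "uniformly_continuous_on UNIV q" "\<And>t. norm (q t) = 1"
  shows "uniformly_continuous_on UNIV (\<lambda>t. q t * peak \<eta> k (cis t))"
  unfolding uniformly_continuous_on_def dist_norm
proof (intro allI impI)
  fix e :: real assume "0 < e"
  define K where "K = 2 / (1 - exp (- \<eta>)) * 2 ^ k"
  have K: "0 < K" using assms(1) by (simp add: K_def)
  have lip: "norm (peak \<eta> k (cis s) - peak \<eta> k (cis t)) \<le> K * \<bar>s - t\<bar>" for s t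
  proof -
    have "norm (peak \<eta> k (cis s) - peak \<eta> k (cis t))
        \<le> 2 / (1 - exp (- \<eta>)) * norm (cis (2 ^ k * s) - cis (2 ^ k * t))"
      unfolding peak_def Complex.DeMoivre using assms(1) by (intro order_trans[OF disc_map_lipschitz]) auto
    also have "\<dots> \<le> 2 / (1 - exp (- \<eta>)) * \<bar>2 ^ k * s - 2 ^ k * t\<bar>"
      using assms(1) norm_cis_diff_le by (intro mult_left_mono) auto
    also have "\<dots> = K * \<bar>s - t\<bar>"
      by (simp add: K_def abs_mult flip: right_diff_distrib)
    finally show ?thesis .
  qed
  obtain d where d: "0 < d" "\<And>s t. norm (s - t) < d \<Longrightarrow> norm (q s - q t) < e / 2"
    using q(1)[unfolded uniformly_continuous_on_def dist_norm, rule_format, of "e / 2"] \<open>0 < e\<close> by auto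
  show "\<exists>d>0. \<forall>t\<in>UNIV. \<forall>s\<in>UNIV. norm (s - t) < d
      \<longrightarrow> norm (q s * peak \<eta> k (cis s) - q t * peak \<eta> k (cis t)) < e"
  proof (intro exI[of _ "min d (e / (2 * K))"] conjI ballI impI)
    show "0 < min d (e / (2 * K))" using d \<open>0 < e\<close> K by simp
    fix s t :: real assume st: "norm (s - t) < min d (e / (2 * K))"
    have "q s * peak \<eta> k (cis s) - q t * peak \<eta> k (cis t)
        = (q s - q t) * peak \<eta> k (cis s) + q t * (peak \<eta> k (cis s) - peak \<eta> k (cis t))"
      by (simp add: algebra_simps)
    also have "norm \<dots> \<le> norm (q s - q t) + norm (peak \<eta> k (cis s) - peak \<eta> k (cis t))"
      using norm_triangle_ineq[of "(q s - q t) * peak \<eta> k (cis s)" "q t * (peak \<eta> k (cis s) - peak \<eta> k (cis t))"]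
      by (simp add: norm_mult q(2) norm_peak_cis[OF assms(1)])
    also have "\<dots> < e / 2 + e / 2"
    proof (rule add_less_le_mono)
      show "norm (q s - q t) < e / 2" using d(2) st by simp
      have "K * \<bar>s - t\<bar> \<le> K * (e / (2 * K))" using st K by (intro mult_left_mono) auto
      then show "norm (peak \<eta> k (cis s) - peak \<eta> k (cis t)) \<le> e / 2"
        using lip[of s t] K by simp
    qed
    finally show "norm (q s * peak \<eta> k (cis s) - q t * peak \<eta> k (cis t)) < e" by simp
  qed
qed

lemma norm_blaschke_factor_minus_1:
  assumes "0 < a" "a < 1" "norm z < 1"
  shows "norm (blaschke_factor (of_real a * cis \<theta>) z - 1) \<le> 2 / (1 - norm z) * (1 - a)"
proof -
  define w where "w = cis (- \<theta>) * z"
  have w: "norm w = norm z" by (simp add: w_def norm_mult)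
  have "a * norm z \<le> 1 * norm z" using assms by (intro mult_right_mono) auto
  then have "1 - norm z \<le> norm (1 - of_real a * w)"
    using norm_triangle_ineq2[of 1 "of_real a * w"] assms by (simp add: norm_mult w)
  then have "2 * (1 - a) / norm (1 - of_real a * w) \<le> 2 * (1 - a) / (1 - norm z)"
    using assms by (intro divide_left_mono mult_pos_pos) auto
  moreover have "norm (disc_map a w - 1) \<le> 2 * (1 - a) / norm (1 - of_real a * w)"
    using assms w by (intro norm_disc_map_minus_1) auto
  ultimately show ?thesis
    unfolding blaschke_factor_eq_disc_map[OF assms(1)] w_def[symmetric] by simp
qed

lemma sum_lessThan_add:
  "(\<Sum>i<m + n. f i) = (\<Sum>i<m. f i) + (\<Sum>j<n. f (m + j))" for f :: "nat \<Rightarrow> 'a :: comm_monoid_add"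
  by (induction n) (simp_all add: add_ac)

text \<open>
  The zeros are enumerated factor after factor: block \<open>n\<close> occupies the indices \<open>S n, \<dots>, S n + 2 ^ k n - 1\<close> and
  lists the zeros of the \<open>n\<close>-th peak.  Each zero of block \<open>n\<close> lies within \<open>\<eta> n / 2 ^ k n\<close> of the circle, which gives
  the Blaschke condition and absolute convergence.  The partial products at the ends of blocks are
  the products of peaks.
\<close>

lemma blaschke_product_of_peaks:
  assumes \<eta>: "\<And>n. 0 < \<eta> n" and sum: "summable \<eta>"
  obtains b where "is_blaschke_product b"
    and "\<And>z. norm z < 1 \<Longrightarrow> (\<lambda>n. \<Prod>m<n. peak (\<eta> m) (k m) z) \<longlonglongrightarrow> b z"
proof -
  define S where "S n = (\<Sum>m<n. 2 ^ k m :: nat)" for n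
  have S_Suc: "S (Suc n) = S n + 2 ^ k n" for n by (simp add: S_def)
  have S_mono: "strict_mono S" by (rule strict_monoI_Suc) (simp add: S_Suc)
  define block where "block i = (LEAST n. i < S (Suc n))" for i
  have block: "block (S n + j) = n" if "j < 2 ^ k n" for n j
    unfolding block_def
  proof (rule Least_equality)
    show "S n + j < S (Suc n)" using that by (simp add: S_Suc)
    fix m assume "S n + j < S (Suc m)"
    then have "S n < S (Suc m)" by simp
    then show "n \<le> m" using strict_mono_less[OF S_mono] by simp
  qed
  define \<rho> where "\<rho> n = exp (- (\<eta> n / 2 ^ k n))" for n
  have \<rho>: "0 < \<rho> n" "\<rho> n < 1" for n using \<eta> by (auto simp: \<rho>_def)
  define a where "a i = complex_of_real (\<rho> (block i)) * cis (2 * pi * real (i - S (block i)) / 2 ^ k (block i))" for i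
  have norm_a: "norm (a i) = \<rho> (block i)" for i using \<rho>[of "block i"] by (simp add: a_def norm_mult)
  have partial: "(\<Sum>i<S n. 1 - norm (a i)) \<le> suminf \<eta>" for n
  proof -
    have "(\<Sum>i<S n. 1 - norm (a i)) = (\<Sum>m<n. 2 ^ k m * (1 - \<rho> m))"
    proof (induction n)
      case (Suc n)
      then show ?case by (simp add: S_Suc sum_lessThan_add norm_a block)
    qed (simp add: S_def)
    also have "\<dots> \<le> (\<Sum>m<n. \<eta> m)"
    proof (rule sum_mono)
      fix m
      have "1 - \<rho> m \<le> \<eta> m / 2 ^ k m" unfolding \<rho>_def using exp_ge_add_one_self[of "- (\<eta> m / 2 ^ k m)"] by simp
      then show "2 ^ k m * (1 - \<rho> m) \<le> \<eta> m" by (simp add: field_simps)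
    qed
    also have "\<dots> \<le> suminf \<eta>" using \<eta> sum by (intro sum_le_suminf) (auto intro: less_imp_le)
    finally show ?thesis .
  qed
  have summable: "summable (\<lambda>i. 1 - norm (a i))"
  proof (rule bounded_imp_summable)
    show "0 \<le> 1 - norm (a i)" for i using \<rho>[of "block i"] by (simp add: norm_a)
    fix n
    have "n < S (Suc n)" using strict_mono_imp_increasing[OF S_mono, of "Suc n"] by simp
    then have "(\<Sum>i\<le>n. 1 - norm (a i)) \<le> (\<Sum>i<S (Suc n). 1 - norm (a i))"
      using \<rho> by (intro sum_mono2) (auto simp: norm_a less_imp_le)
    then show "(\<Sum>i\<le>n. 1 - norm (a i)) \<le> suminf \<eta>" using partial[of "Suc n"] by simp
  qed
  define b where "b z = prodinf (\<lambda>i. blaschke_factor (a i) z)" for z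
  have conv: "convergent_prod (\<lambda>i. blaschke_factor (a i) z)" if z: "norm z < 1" for z
  proof (intro abs_convergent_prod_imp_convergent_prod summable_imp_abs_convergent_prod)
    show "summable (\<lambda>i. norm (blaschke_factor (a i) z - 1))"
    proof (rule summable_comparison_test'[OF summable_mult[OF summable, of "2 / (1 - norm z)"]])
      show "norm (norm (blaschke_factor (a i) z - 1)) \<le> 2 / (1 - norm z) * (1 - norm (a i))" for i
        unfolding norm_a unfolding a_def using norm_blaschke_factor_minus_1[OF \<rho> z] by simp
    qed
  qed
  show thesis
  proof
    show "is_blaschke_product b"
      unfolding is_blaschke_product_def
    proof (intro exI[of _ UNIV] exI[of _ a] conjI ballI)
      show "norm (a n) < 1" for n using \<rho>(2) by (simp add: norm_a)
      show "(\<lambda>n. 1 - norm (a n)) summable_on UNIV"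
        using summable \<rho> by (subst summable_on_UNIV_nonneg_real_iff) (auto simp: norm_a less_imp_le)
      show "(\<lambda>n. if n \<in> UNIV then blaschke_factor (a n) z else 1) has_prod b z" if "z \<in> ball 0 1" for z
        using conv[of z] that by (simp add: b_def convergent_prod_has_prod_iff)
    qed
    fix z :: complex assume z: "norm z < 1"
    have "(\<lambda>n. \<Prod>i<Suc n. blaschke_factor (a i) z) \<longlonglongrightarrow> b z"
      unfolding lessThan_Suc_atMost b_def by (rule convergent_prod_LIMSEQ[OF conv[OF z]])
    then have "(\<lambda>n. \<Prod>i<n. blaschke_factor (a i) z) \<longlonglongrightarrow> b z" by (rule LIMSEQ_imp_Suc)
    from LIMSEQ_subseq_LIMSEQ[OF this S_mono]
    have "(\<lambda>n. \<Prod>i<S n. blaschke_factor (a i) z) \<longlonglongrightarrow> b z" by (simp add: o_def)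
    moreover have "(\<Prod>i<S n. blaschke_factor (a i) z) = (\<Prod>m<n. peak (\<eta> m) (k m) z)" for n
    proof (induction n)
      case (Suc n)
      have "(\<Prod>j<2 ^ k n. blaschke_factor (a (S n + j)) z)
          = (\<Prod>j<2 ^ k n. disc_map (\<rho> n) (cis (- (2 * pi * real j / 2 ^ k n)) * z))"
        by (intro prod.cong) (auto simp: a_def block blaschke_factor_eq_disc_map[OF \<rho>(1)])
      also have "\<dots> = disc_map (\<rho> n ^ 2 ^ k n) (z ^ 2 ^ k n)"
        using \<rho>[of n] z by (intro prod_disc_map_roots_of_unity) auto
      also have "\<rho> n ^ 2 ^ k n = exp (- \<eta> n)"
        by (simp add: \<rho>_def flip: exp_of_nat_mult)
      finally show ?case using Suc by (simp add: S_Suc prod_lessThan_add peak_def)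
    qed (simp add: S_def)
    ultimately show "(\<lambda>n. \<Prod>m<n. peak (\<eta> m) (k m) z) \<longlonglongrightarrow> b z" by simp
  qed
qed

section \<open>The exceptional sets\<close>

text \<open>
  Borel--Cantelli on each period separately, since the grid neighbourhoods have infinite measure on the
  line.
\<close>

lemma AE_eventually_not_near_grid:
  assumes d: "\<And>n. 0 < d n" "\<And>n. d n \<le> 1 / 2 ^ n"
  shows "AE x in lebesgue. \<forall>\<^sub>F n in sequentially. x \<notin> near_grid (k n) (d n)"
proof -
  have minus: "0 - x \<in> near_grid K h \<longleftrightarrow> x \<in> near_grid K h" for x K h
  proof -
    have "0 - x \<in> near_grid K h" if x: "x \<in> near_grid K h" for x
    proof -
      obtain j :: int where "\<bar>2 ^ K * x - 2 * pi * of_int j\<bar> < h" using x by (auto simp: near_grid_def)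
      then have "\<bar>2 ^ K * (0 - x) - 2 * pi * of_int (- j)\<bar> < h" by (simp add: abs_minus_commute)
      then show ?thesis unfolding near_grid_def by blast
    qed
    from this[of x] this[of "0 - x"] show ?thesis by auto
  qed
  have "AE x in lebesgue. x \<in> {2 * pi * of_int i..<2 * pi * of_int i + 2 * pi}
      \<longrightarrow> (\<forall>\<^sub>F n in sequentially. x \<notin> near_grid (k n) (d n))" for i :: int
  proof -
    define A where "A n = {2 * pi * of_int i..<2 * pi * of_int i + 2 * pi} \<inter> near_grid (k n) (d n)" for n
    have A: "emeasure lebesgue (A n) \<le> ennreal (6 * d n)" for n
    proof -
      have "(1::real) / 2 ^ n \<le> 1" by simp
      then have "d n \<le> pi" using d(2)[of n] pi_gt3 by linarith
      moreover have "A n = {u \<in> {2 * pi * of_int i..<2 * pi * of_int i + 2 * pi}. 0 - u \<in> near_grid (k n) (d n)}"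
        unfolding minus by (auto simp: A_def)
      ultimately show ?thesis using emeasure_near_grid_le[OF d(1), of n "2 * pi * of_int i" 0 "k n"]
        by (simp only:)
    qed
    have "AE x in lebesgue. eventually (\<lambda>n. x \<in> space lebesgue - A n) sequentially"
    proof (rule borel_cantelli_AE1)
      show "A n \<in> sets lebesgue" for n unfolding A_def using open_near_grid by auto
      show "emeasure lebesgue (A n) < \<infinity>" for n
        using A[of n] by (rule le_less_trans) simp
      have "measure lebesgue (A n) \<le> 6 * (1 / 2) ^ n" for n
      proof -
        have "measure lebesgue (A n) \<le> 6 * d n"
          unfolding measure_def using A[of n] d(1)[of n] by (intro enn2real_leI) auto
        then show ?thesis using d(2)[of n] by (simp add: power_divide)
      qed
      then show "summable (\<lambda>n. measure lebesgue (A n))"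
        by (intro summable_comparison_test'[OF summable_mult[OF summable_geometric[of "1/2"], of 6]]) auto
    qed
    then show ?thesis
      by eventually_elim (auto simp: A_def elim: eventually_mono)
  qed
  then have "AE x in lebesgue. \<forall>i::int. x \<in> {2 * pi * of_int i..<2 * pi * of_int i + 2 * pi}
      \<longrightarrow> (\<forall>\<^sub>F n in sequentially. x \<notin> near_grid (k n) (d n))"
    unfolding AE_all_countable ..
  then show ?thesis
  proof eventually_elim
    case (elim x)
    define i where "i = \<lfloor>x / (2 * pi)\<rfloor>"
    have "of_int i \<le> x / (2 * pi)" "x / (2 * pi) < of_int i + 1" unfolding i_def by linarith+
    then have "x \<in> {2 * pi * of_int i..<2 * pi * of_int i + 2 * pi}" by (auto simp: field_simps)
    then show ?case using elim by blast
  qed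
qed

text \<open>
  The tolerances at least halve at each step, so the bounds \<open>6 d m\<close> sum to at most \<open>12 d n\<close>.
\<close>

lemma emeasure_tail_near_grid_le:
  assumes d: "\<And>m. 0 < d m" "\<And>m. d (Suc m) \<le> d m / 2" "d n \<le> 1"
  shows "emeasure lebesgue {u \<in> circle_dom. y - u \<in> (\<Union>m\<in>{n..}. near_grid (k m) (d m))} \<le> ennreal (12 * d n)"
proof -
  have dm: "d (n + i) \<le> d n * (1 / 2) ^ i" for i
  proof (induction i)
    case (Suc i)
    then show ?case using d(2)[of "n + i"] by simp
  qed simp
  define A where "A i = {u \<in> circle_dom. y - u \<in> near_grid (k (n + i)) (d (n + i))}" for i
  have A_sets: "A i \<in> sets lebesgue" for i
  proof -
    have "A i = circle_dom \<inter> (\<lambda>u. y - u) -` near_grid (k (n + i)) (d (n + i))" by (auto simp: A_def)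
    moreover have "open ((\<lambda>u. y - u) -` near_grid (k (n + i)) (d (n + i)))"
      by (intro open_vimage continuous_intros open_near_grid)
    ultimately show ?thesis by auto
  qed
  have A: "emeasure lebesgue (A i) \<le> ennreal (6 * d n * (1 / 2) ^ i)" for i
  proof -
    have "(1 / 2 :: real) ^ i \<le> 1" by (intro power_le_one) auto
    then have "d n * (1 / 2) ^ i \<le> 1 * 1" using d by (intro mult_mono) (auto intro: less_imp_le)
    then have "d (n + i) \<le> pi" using dm[of i] pi_gt3 by linarith
    then have "emeasure lebesgue (A i) \<le> ennreal (6 * d (n + i))"
      using emeasure_near_grid_le[of "d (n + i)" "- pi" y "k (n + i)"] d(1) by (simp add: A_def)
    also have "\<dots> \<le> ennreal (6 * d n * (1 / 2) ^ i)" using dm[of i] by (intro ennreal_leI) simp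
    finally show ?thesis .
  qed
  have "{u \<in> circle_dom. y - u \<in> (\<Union>m\<in>{n..}. near_grid (k m) (d m))} = (\<Union>i. A i)"
    by (auto simp: A_def dest!: le_Suc_ex)
  then have "emeasure lebesgue {u \<in> circle_dom. y - u \<in> (\<Union>m\<in>{n..}. near_grid (k m) (d m))}
      \<le> (\<Sum>i. emeasure lebesgue (A i))"
    using A_sets by (simp only:) (intro emeasure_subadditive_countably, auto)
  also have "\<dots> \<le> (\<Sum>i. ennreal (6 * d n * (1 / 2) ^ i))"
    using A by (intro suminf_le) auto
  also have "\<dots> = ennreal (6 * d n * (1 / (1 - 1 / 2)))"
    using d(1)[of n] by (intro suminf_ennreal_eq sums_mult geometric_sums) auto
  finally show ?thesis by simp
qed

section \<open>The divergent Blaschke product\<close>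

theorem theorem2p2:
  fixes \<phi> :: "real \<Rightarrow> real \<Rightarrow> real" and l :: "real \<Rightarrow> real"
  assumes "\<And>r. 0 < r \<Longrightarrow> r < 1 \<Longrightarrow> Linf_circle (\<phi> r)"
    and "Phi1 \<phi>" and "Phi4 \<phi>" and "Phi5 \<phi>"
    and "continuous_on {0..1} l" and "l 1 = 0"
    and "Pi_star l \<phi> = 1"
  shows "\<exists>B :: real \<Rightarrow> complex. Linf_circle B \<and>
           (\<exists>b. is_blaschke_product b \<and> is_boundary_function B b) \<and>
           (\<forall>x. \<not> (\<exists>L. ((\<lambda>r. kernel_integral \<phi> r (x + l r) B) \<longlongrightarrow> L) (at_left 1)))"
proof -
  \<comment> \<open>A state consists of the product so far, the tolerance for the next exceptional set, and the
    parameters \<open>\<eta>\<close>, \<open>k\<close> of the factor chosen last.\<close>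
  define Inv :: "nat \<Rightarrow> (real \<Rightarrow> complex) \<times> real \<times> real \<times> nat \<Rightarrow> bool" where
    "Inv n = (\<lambda>(q, d, _, _). (n = 0 \<longrightarrow> q = (\<lambda>_. 1)) \<and> uniformly_continuous_on UNIV q \<and> (\<forall>t. norm (q t) = 1) \<and> 0 < d \<and> d \<le> 1)" for n
  \<comment> \<open>The bounds \<open>1 / 100 / 2 ^ n\<close> sum, over the stages after any given one, to at most the 1/100 that its
    oscillation property tolerates.\<close>
  define Step :: "nat \<Rightarrow> (real \<Rightarrow> complex) \<times> real \<times> real \<times> nat \<Rightarrow> (real \<Rightarrow> complex) \<times> real \<times> real \<times> nat \<Rightarrow> bool" where
    "Step n = (\<lambda>(q, d, _, _) (q', d', \<eta>, k). 0 < \<eta> \<and> \<eta> \<le> d \<and> d' \<le> d / 2 \<and>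
       q' = (\<lambda>t. q t * peak \<eta> k (cis t)) \<and>
       (\<forall>x \<rho>. x \<notin> near_grid k d \<longrightarrow> 0 \<le> \<rho> \<longrightarrow> \<rho> \<le> 1 \<longrightarrow>
          norm (peak \<eta> k (of_real \<rho> * cis x) - 1) \<le> 1 / 100 / 2 ^ n) \<and>
       (\<forall>G E x. G \<in> borel_measurable borel \<longrightarrow> (\<forall>t. G (t + 2 * pi) = G t) \<longrightarrow> (\<forall>t. norm (G t) \<le> 1) \<longrightarrow>
           open E \<longrightarrow> (\<forall>y. emeasure lebesgue {u \<in> circle_dom. y - u \<in> E} \<le> ennreal (12 * d')) \<longrightarrow>
           (\<forall>t. t \<notin> E \<longrightarrow> norm (G t - q t * peak \<eta> k (cis t)) \<le> 1 / 100) \<longrightarrow>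
           (\<exists>r r'. 1 - 1 / 2 ^ n < r \<and> r < 1 \<and> 1 - 1 / 2 ^ n < r' \<and> r' < 1 \<and>
               1 \<le> norm (kernel_integral \<phi> r (x + l r) G - kernel_integral \<phi> r' (x + l r') G))))" for n
  have "\<exists>f. \<forall>n. Inv n (f n) \<and> Step n (f n) (f (Suc n))"
  proof (rule dependent_nat_choice)
    show "\<exists>s. Inv 0 s"
      by (rule exI[of _ "(\<lambda>_. 1, 1, 0, 0)"]) (simp add: Inv_def uniformly_continuous_on_const)
    fix s n assume Inv: "Inv n s"
    obtain q d \<eta>0 k0 where s: "s = (q, d, \<eta>0, k0)" by (cases s) auto
    have q: "uniformly_continuous_on UNIV q" "\<And>t. norm (q t) = 1" and d: "0 < d" "d \<le> 1"
      using Inv by (auto simp: Inv_def s)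
    show "\<exists>s'. Inv (Suc n) s' \<and> Step n s s'"
    proof (rule oscillation_stage[OF assms q d, of "1 / 100 / 2 ^ n" "1 - 1 / 2 ^ n"])
      fix \<eta> k d'
      assume \<eta>: "0 < \<eta>" "\<eta> \<le> d" and d': "0 < d'" "d' \<le> d / 2"
        and close: "\<And>x \<rho>. \<lbrakk>x \<notin> near_grid k d; 0 \<le> \<rho>; \<rho> \<le> 1\<rbrakk>
          \<Longrightarrow> norm (peak \<eta> k (of_real \<rho> * cis x) - 1) \<le> 1 / 100 / 2 ^ n"
        and osc: "\<And>G E x. \<lbrakk>G \<in> borel_measurable borel; \<And>t. G (t + 2 * pi) = G t; \<And>t. norm (G t) \<le> 1;
           open E; \<And>y. emeasure lebesgue {u \<in> circle_dom. y - u \<in> E} \<le> ennreal (12 * d');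
           \<And>t. t \<notin> E \<Longrightarrow> norm (G t - q t * peak \<eta> k (cis t)) \<le> 1 / 100\<rbrakk>
         \<Longrightarrow> \<exists>r r'. 1 - 1 / 2 ^ n < r \<and> r < 1 \<and> 1 - 1 / 2 ^ n < r' \<and> r' < 1 \<and>
               1 \<le> norm (kernel_integral \<phi> r (x + l r) G - kernel_integral \<phi> r' (x + l r') G)"
      define s' where "s' = (\<lambda>t. q t * peak \<eta> k (cis t), d', \<eta>, k)"
      have "Inv (Suc n) s'"
        using uniformly_continuous_mult_peak[OF \<eta>(1) q] q(2) norm_peak_cis[OF \<eta>(1)] d d'
        by (simp add: Inv_def s'_def norm_mult)
      moreover have "Step n s s'"
        unfolding Step_def s s'_def prod.case
        by (intro conjI allI impI \<eta> d' refl close osc) auto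
      ultimately show ?thesis by blast
    qed auto
  qed
  then obtain f where f: "\<And>n. Inv n (f n)" "\<And>n. Step n (f n) (f (Suc n))" by blast
  define q where "q n = fst (f n)" for n
  define d where "d n = fst (snd (f n))" for n
  define \<eta> where "\<eta> n = fst (snd (snd (f (Suc n))))" for n
  define k where "k n = snd (snd (snd (f (Suc n))))" for n
  have d: "0 < d n" "d n \<le> 1" for n
    using f(1)[of n] by (auto simp: Inv_def d_def split: prod.splits)
  have Step: "Step n (q n, d n, undefined, undefined) (q (Suc n), d (Suc n), \<eta> n, k n)" for n
    using f(2)[of n] by (simp add: Step_def q_def d_def \<eta>_def k_def split_beta)
  have \<eta>: "0 < \<eta> n" "\<eta> n \<le> d n" and d_Suc: "d (Suc n) \<le> d n / 2"
    and q_Suc: "q (Suc n) = (\<lambda>t. q n t * peak (\<eta> n) (k n) (cis t))" for n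
    using Step[of n] by (auto simp: Step_def)
  have close: "norm (peak (\<eta> n) (k n) (of_real \<rho> * cis x) - 1) \<le> 1 / 100 / 2 ^ n"
    if "x \<notin> near_grid (k n) (d n)" "0 \<le> \<rho>" "\<rho> \<le> 1" for n x \<rho>
    using Step[of n] that by (auto simp: Step_def)
  have osc: "\<exists>r r'. 1 - 1 / 2 ^ n < r \<and> r < 1 \<and> 1 - 1 / 2 ^ n < r' \<and> r' < 1 \<and>
               1 \<le> norm (kernel_integral \<phi> r (x + l r) G - kernel_integral \<phi> r' (x + l r') G)"
    if "G \<in> borel_measurable borel" "\<And>t. G (t + 2 * pi) = G t" "\<And>t. norm (G t) \<le> 1"
       "open E" "\<And>y. emeasure lebesgue {u \<in> circle_dom. y - u \<in> E} \<le> ennreal (12 * d (Suc n))"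
       "\<And>t. t \<notin> E \<Longrightarrow> norm (G t - q n t * peak (\<eta> n) (k n) (cis t)) \<le> 1 / 100" for n G E x
    by (rule Step[of n, unfolded Step_def prod.case, THEN conjunct2, THEN conjunct2, THEN conjunct2,
          THEN conjunct2, THEN conjunct2, rule_format]) (fact that | rule that)+
  have d_le: "d n \<le> 1 / 2 ^ n" for n
  proof (induction n)
    case (Suc n)
    then show ?case using d_Suc[of n] by simp
  qed (simp add: d)
  have "summable \<eta>"
  proof (rule summable_comparison_test'[OF summable_geometric[of "1/2::real"]])
    show "norm (\<eta> n) \<le> (1 / 2) ^ n" for n
      using \<eta>[of n] d_le[of n] by (simp add: power_divide)
  qed simp
  then obtain b where b: "is_blaschke_product b"
    and b_lim: "\<And>z. norm z < 1 \<Longrightarrow> (\<lambda>n. \<Prod>m<n. peak (\<eta> m) (k m) z) \<longlonglongrightarrow> b z"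
    by (rule blaschke_product_of_peaks[of \<eta> k, OF \<eta>(1)]) blast
  define W where "W n z = (\<Prod>m<n. peak (\<eta> m) (k m) z)" for n z
  have norm_W: "norm (W n z) \<le> 1" if "norm z \<le> 1" for n z
    unfolding W_def prod_norm[symmetric] using norm_peak_le_1[OF \<eta>(1) that] by (intro prod_le_1) auto
  have W_cont: "continuous_on S (\<lambda>s. W n (g s))" if "continuous_on S g" "\<And>s. s \<in> S \<Longrightarrow> norm (g s) \<le> 1" for n S and g :: "real \<Rightarrow> complex"
    unfolding W_def using that by (intro continuous_on_prod continuous_on_peak \<eta>(1))
  have increment: "norm (W (Suc n) (of_real \<rho> * cis x) - W n (of_real \<rho> * cis x)) \<le> 1 / 100 / 2 ^ n"
    if "x \<notin> near_grid (k n) (d n)" "0 \<le> \<rho>" "\<rho> \<le> 1" for n x \<rho>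
  proof -
    have "W (Suc n) (of_real \<rho> * cis x) - W n (of_real \<rho> * cis x)
        = W n (of_real \<rho> * cis x) * (peak (\<eta> n) (k n) (of_real \<rho> * cis x) - 1)"
      by (simp add: W_def algebra_simps)
    also have "norm \<dots> \<le> 1 * (1 / 100 / 2 ^ n)"
      unfolding norm_mult using that by (intro mult_mono norm_W close) (auto simp: norm_mult)
    finally show ?thesis by simp
  qed
  have tail: "convergent (\<lambda>n. W n (of_real \<rho> * cis x))"
      "norm (lim (\<lambda>n. W n (of_real \<rho> * cis x)) - W n (of_real \<rho> * cis x)) \<le> 2 * (1 / 100) / 2 ^ n"
    if "\<And>m. n \<le> m \<Longrightarrow> x \<notin> near_grid (k m) (d m)" "0 \<le> \<rho>" "\<rho> \<le> 1" for n x \<rho>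
    using geometric_increments[of n "\<lambda>n. W n (of_real \<rho> * cis x)" "1 / 100"] increment that by blast+
  \<comment> \<open>On the null set of divergence the value 1 keeps \<open>B\<close> bounded by 1 everywhere.\<close>
  define B where "B t = (if convergent (\<lambda>n. W n (cis t)) then lim (\<lambda>n. W n (cis t)) else 1)" for t
  have B_periodic: "B (t + 2 * pi) = B t" for t
    by (simp add: B_def flip: cis_mult)
  have B_norm: "norm (B t) \<le> 1" for t
  proof (cases "convergent (\<lambda>n. W n (cis t))")
    case True
    then have "(\<lambda>n. W n (cis t)) \<longlonglongrightarrow> B t" by (simp add: B_def convergent_LIMSEQ_iff)
    then show ?thesis
      by (rule LIMSEQ_le_const2[OF tendsto_norm]) (use norm_W in auto)
  qed (simp add: B_def)
  have B_meas: "B \<in> borel_measurable borel"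
  proof -
    have [measurable]: "(\<lambda>t. W n (cis t)) \<in> borel_measurable borel" for n
      by (intro borel_measurable_continuous_onI W_cont continuous_intros) auto
    show ?thesis unfolding B_def Cauchy_convergent_iff[symmetric] by measurable
  qed
  have "Linf_circle B"
    unfolding Linf_circle_def
    using B_periodic B_norm measurable_completion[of B lborel borel] B_meas by auto
  moreover have "is_boundary_function B b"
    unfolding is_boundary_function_def
    using AE_eventually_not_near_grid[of d k, OF d(1) d_le]
  proof eventually_elim
    case (elim x)
    then obtain n0 where n0: "\<And>m. n0 \<le> m \<Longrightarrow> x \<notin> near_grid (k m) (d m)"
      by (auto simp: eventually_sequentially)
    \<comment> \<open>The limit along the closed radius through \<open>x\<close>: the Blaschke product for \<open>\<rho> < 1\<close> and \<open>B x\<close> for \<open>\<rho> = 1\<close>.\<close>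
    define V where "V \<rho> = lim (\<lambda>n. W n (of_real \<rho> * cis x))" for \<rho> :: real
    have V_B: "V 1 = B x"
      using tail(1)[of n0 x 1] n0 by (simp add: V_def B_def)
    have V_b: "V \<rho> = b (of_real \<rho> * cis x)" if "0 \<le> \<rho>" "\<rho> < 1" for \<rho>
      unfolding V_def W_def using that by (intro limI b_lim) (simp add: norm_mult)
    have "uniform_limit {0..1} (\<lambda>n \<rho>. W n (of_real \<rho> * cis x)) V sequentially"
    proof (rule uniform_limitI)
      fix e :: real assume "0 < e"
      have "(\<lambda>n. 2 * (1 / 100) * (1 / 2) ^ n) \<longlonglongrightarrow> 2 * (1 / 100) * (0::real)"
        by (intro tendsto_intros LIMSEQ_realpow_zero) auto
      then have "\<forall>\<^sub>F n in sequentially. 2 * (1 / 100) * (1 / 2) ^ n < e"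
        using \<open>0 < e\<close> by (intro order_tendstoD(2)) auto
      with eventually_ge_at_top[of n0]
      show "\<forall>\<^sub>F n in sequentially. \<forall>\<rho>\<in>{0..1}. dist (W n (of_real \<rho> * cis x)) (V \<rho>) < e"
      proof eventually_elim
        case (elim n)
        show ?case
        proof
          fix \<rho> :: real assume "\<rho> \<in> {0..1}"
          then have "norm (V \<rho> - W n (of_real \<rho> * cis x)) \<le> 2 * (1 / 100) / 2 ^ n"
            unfolding V_def using n0 elim(1) by (intro tail) auto
          then show "dist (W n (of_real \<rho> * cis x)) (V \<rho>) < e"
            using elim(2) by (simp add: dist_norm norm_minus_commute power_divide)
        qed
      qed
    qed
    then have "continuous_on {0..1} V"
      by (rule uniform_limit_theorem[rotated])
         (auto intro!: always_eventually W_cont continuous_intros simp: norm_mult)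
    then have "(V \<longlongrightarrow> V 1) (at 1 within {0..1})" by (auto simp: continuous_on_def)
    then have "(V \<longlongrightarrow> B x) (at_left 1)" by (simp add: at_within_Icc_at_left V_B)
    moreover have "\<forall>\<^sub>F \<rho> in at_left 1. \<rho> \<in> {0<..<(1::real)}" by (rule eventually_at_left_real) simp
    then have "\<forall>\<^sub>F \<rho> in at_left 1. V \<rho> = b (of_real \<rho> * cis x)"
      by eventually_elim (auto intro: V_b)
    ultimately show ?case by (rule Lim_transform_eventually)
  qed
  moreover have "\<not> (\<exists>L. ((\<lambda>r. kernel_integral \<phi> r (x + l r) B) \<longlongrightarrow> L) (at_left 1))" for x
  proof
    assume "\<exists>L. ((\<lambda>r. kernel_integral \<phi> r (x + l r) B) \<longlongrightarrow> L) (at_left 1)"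
    then obtain L where "((\<lambda>r. kernel_integral \<phi> r (x + l r) B) \<longlongrightarrow> L) (at_left 1)" by blast
    from tendstoD[OF this, of "1/2"]
    have "\<forall>\<^sub>F r in at_left 1. dist (kernel_integral \<phi> r (x + l r) B) L < 1/2" by simp
    then obtain \<beta> where \<beta>: "\<beta> < 1"
      "\<And>r. \<beta> < r \<Longrightarrow> r < 1 \<Longrightarrow> dist (kernel_integral \<phi> r (x + l r) B) L < 1/2"
      by (rule eventually_at_left_1D) blast
    obtain n where n: "(1/2) ^ n < 1 - \<beta>"
      using real_arch_pow_inv[of "1 - \<beta>" "1/2"] \<beta>(1) by auto
    have q: "q n t = W n (cis t)" for n t
    proof (induction n)
      case 0
      then show ?case using f(1)[of 0] by (auto simp: Inv_def q_def W_def split: prod.splits)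
    qed (auto simp: W_def q_Suc)
    have "\<exists>r r'. 1 - 1 / 2 ^ n < r \<and> r < 1 \<and> 1 - 1 / 2 ^ n < r' \<and> r' < 1 \<and>
        1 \<le> norm (kernel_integral \<phi> r (x + l r) B - kernel_integral \<phi> r' (x + l r') B)"
    proof (rule osc[where E = "\<Union>m\<in>{Suc n..}. near_grid (k m) (d m)"])
      show "open (\<Union>m\<in>{Suc n..}. near_grid (k m) (d m))" by (intro open_UN ballI open_near_grid)
      show "emeasure lebesgue {u \<in> circle_dom. y - u \<in> (\<Union>m\<in>{Suc n..}. near_grid (k m) (d m))}
          \<le> ennreal (12 * d (Suc n))" for y
        by (rule emeasure_tail_near_grid_le[of d, OF d(1) d_Suc d(2)])
      fix t assume t: "t \<notin> (\<Union>m\<in>{Suc n..}. near_grid (k m) (d m))"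
      have "norm (B t - W (Suc n) (cis t)) \<le> 2 * (1 / 100) / 2 ^ Suc n"
        using tail[of "Suc n" t 1] t by (simp add: B_def)
      also have "\<dots> \<le> 1 / 100" by (simp add: divide_le_eq)
      also have "W (Suc n) (cis t) = q n t * peak (\<eta> n) (k n) (cis t)"
        by (simp add: q W_def)
      finally show "norm (B t - q n t * peak (\<eta> n) (k n) (cis t)) \<le> 1 / 100" .
    qed (fact B_meas B_periodic B_norm)+
    then obtain r r' where r: "1 - 1 / 2 ^ n < r" "r < 1" "1 - 1 / 2 ^ n < r'" "r' < 1"
      "1 \<le> norm (kernel_integral \<phi> r (x + l r) B - kernel_integral \<phi> r' (x + l r') B)"
      by (elim exE conjE)
    have "\<beta> < r" "\<beta> < r'" using r n by (auto simp: power_divide)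
    then have "dist (kernel_integral \<phi> r (x + l r) B) (kernel_integral \<phi> r' (x + l r') B) < 1"
      by (intro dist_triangle_half_l[OF \<beta>(2) \<beta>(2)] r)
    then show False using r(5) by (simp add: dist_norm)
  qed
  ultimately show ?thesis using b by blast
qed

end
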